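(* Let $T$ be an infinite rooted tree without leaves (except possibly at the root), let $\mu\neq\nu$ be probability measures on a finite set $\Omega$ with $\mu(\omega)>0$ and $\nu(\omega)>0$ for all $\omega\in\Omega$, and let $\Psi$ be a Borel probability measure on $\partial T$. Let $\Upsilon_+=\{\chi\in\partial T: d_\Psi(\chi)>H(\nu|\mu)\}$ and $\Upsilon_-=\{\chi\in\partial T: d_\Psi(\chi)<H(\nu|\mu)\}$. Let $\Psi_+$ and $\Psi_-$ denote $\Psi$ conditioned on $\Upsilon_+$ and on $\Upsilon_-$, respectively (when these have positive $\Psi$-measure), and write $Q_+=Q_{\Psi_+}$, $Q_-=Q_{\Psi_-}$, $P=\mu^{V(T)}$. (1) If $\Psi(\Upsilon_+)>0$, then $Q_+$ and $P$ are indistinguishable. (2) If $\Psi(\Upsilon_-)>0$, then $Q_-$ and $P$ are singular.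
   Context: A ray of $T$ is an infinite self-avoiding path starting at the root; the boundary $\partial T$ is the set of all rays, with the Borel $\sigma$-algebra generated by the sets $\Upsilon(v)$, $v\in V(T)$, where $\Upsilon(v)$ is the set of rays going through $v$. For a Borel measure $\Psi$ on $\partial T$ write $\Psi(v)=\Psi(\Upsilon(v))$. The local dimension of $\Psi$ on a ray $\chi=(v,v_1,v_2,\ldots)$ is $d_\Psi(\chi)=\liminf_{n\to\infty}\frac{-\log\Psi(v_n)}{n}$. The relative entropy is $H(\nu|\mu)=\sum_{\rho\in\Omega}\nu(\rho)\log\left(\frac{\nu(\rho)}{\mu(\rho)}\right)$. For a ray $\mathcal X$, $[\mathcal X]$ denotes its set of vertices. $P=\mu^{V(T)}$ is the product measure on $\Omega^{V(T)}$, and for a probability measure $\Phi$ on $\partial T$, $Q_\Phi=\int_{\partial T}\nu^{[\mathcal X]}\times\mu^{V(T)\setminus[\mathcal X]}\,d\Phi(\mathcal X)$, i.e. labels are independent given $\mathcal X$, with law $\nu$ on $[\mathcal X]$ and law $\mu$ off $[\mathcal X]$. Two measures are called indistinguishable if they are absolutely continuous with respect to each other. *)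

theory Defs
  imports "HOL-Probability.Probability" "Graph_Theory.Digraph_Component"
begin

text \<open>Undirected simple graphs are symmetric loop-free digraphs with arcs given as pairs. In such a
  digraph every edge gives directed cycles of length 2, so that \<open>Digraph_Component.tree\<close>
  (no directed cycles at all) is not the undirected notion; only cycles with at least three arcs are
  cycles of the undirected graph.\<close>

definition undirected_tree :: "'v pair_pre_digraph \<Rightarrow> bool" where
  "undirected_tree T \<longleftrightarrow>
     pair_bidirected_digraph T \<and> Digraph_Component.connected (with_proj T) \<and>
     (\<nexists>p. pre_digraph.cycle (with_proj T) p \<and> 3 \<le> length p)"

definition leaf :: "'v pair_pre_digraph \<Rightarrow> 'v \<Rightarrow> bool" where
  "leaf T v \<longleftrightarrow> v \<in> pverts T \<and> out_degree (with_proj T) v = 1"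

definition rays :: "'v pair_pre_digraph \<Rightarrow> 'v \<Rightarrow> (nat \<Rightarrow> 'v) set" where
  "rays T r = {\<xi>. \<xi> 0 = r \<and> (\<forall>n. (\<xi> n, \<xi> (Suc n)) \<in> parcs T) \<and> inj \<xi>}"

definition rays_through :: "'v pair_pre_digraph \<Rightarrow> 'v \<Rightarrow> 'v \<Rightarrow> (nat \<Rightarrow> 'v) set" where
  "rays_through T r v = {\<xi> \<in> rays T r. v \<in> range \<xi>}"

definition boundary :: "'v pair_pre_digraph \<Rightarrow> 'v \<Rightarrow> (nat \<Rightarrow> 'v) measure" where
  "boundary T r = sigma (rays T r) (rays_through T r ` pverts T)"

text \<open>The convention is \<open>- log 0 = \<infinity>\<close>, whereas \<open>ln 0 = 0\<close> in the library. The term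
  for \<open>n = 0\<close> does not affect the limit inferior.\<close>

definition local_dim ::
    "'v pair_pre_digraph \<Rightarrow> 'v \<Rightarrow> (nat \<Rightarrow> 'v) measure \<Rightarrow> (nat \<Rightarrow> 'v) \<Rightarrow> ereal" where
  "local_dim T r \<Psi> \<xi> = liminf (\<lambda>n.
     let p = measure \<Psi> (rays_through T r (\<xi> n))
     in if p = 0 then \<infinity> else ereal (- ln p / real n))"

definition rel_entropy :: "'l::finite pmf \<Rightarrow> 'l pmf \<Rightarrow> real" where
  "rel_entropy \<nu> \<mu> = (\<Sum>\<rho>\<in>UNIV. pmf \<nu> \<rho> * ln (pmf \<nu> \<rho> / pmf \<mu> \<rho>))"

definition rays_dim_above ::
    "'v pair_pre_digraph \<Rightarrow> 'v \<Rightarrow> (nat \<Rightarrow> 'v) measure \<Rightarrow> real \<Rightarrow> (nat \<Rightarrow> 'v) set" where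
  "rays_dim_above T r \<Psi> h = {\<xi> \<in> rays T r. local_dim T r \<Psi> \<xi> > ereal h}"

definition rays_dim_below ::
    "'v pair_pre_digraph \<Rightarrow> 'v \<Rightarrow> (nat \<Rightarrow> 'v) measure \<Rightarrow> real \<Rightarrow> (nat \<Rightarrow> 'v) set" where
  "rays_dim_below T r \<Psi> h = {\<xi> \<in> rays T r. local_dim T r \<Psi> \<xi> < ereal h}"

definition iid_labels :: "'v pair_pre_digraph \<Rightarrow> 'l pmf \<Rightarrow> ('v \<Rightarrow> 'l) measure" where
  "iid_labels T \<mu> = PiM (pverts T) (\<lambda>_. measure_pmf \<mu>)"

definition labels_given_ray ::
    "'v pair_pre_digraph \<Rightarrow> 'l pmf \<Rightarrow> 'l pmf \<Rightarrow> (nat \<Rightarrow> 'v) \<Rightarrow> ('v \<Rightarrow> 'l) measure" where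
  "labels_given_ray T \<mu> \<nu> \<xi> =
     PiM (pverts T) (\<lambda>v. measure_pmf (if v \<in> range \<xi> then \<nu> else \<mu>))"

text \<open>The mixture \<open>Q\<^sub>\<Phi>\<close>, as a Giry-monad bind; see \<open>emeasure_hidden_ray_labels\<close> below.\<close>

definition hidden_ray_labels ::
    "'v pair_pre_digraph \<Rightarrow> 'l pmf \<Rightarrow> 'l pmf \<Rightarrow> (nat \<Rightarrow> 'v) measure \<Rightarrow> ('v \<Rightarrow> 'l) measure" where
  "hidden_ray_labels T \<mu> \<nu> \<Phi> = bind \<Phi> (labels_given_ray T \<mu> \<nu>)"

definition indistinguishable :: "'a measure \<Rightarrow> 'a measure \<Rightarrow> bool" where
  "indistinguishable M N \<longleftrightarrow>
     sets M = sets N \<and> absolutely_continuous M N \<and> absolutely_continuous N M"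

definition mutually_singular :: "'a measure \<Rightarrow> 'a measure \<Rightarrow> bool" where
  "mutually_singular M N \<longleftrightarrow>
     sets M = sets N \<and> (\<exists>A\<in>sets M. emeasure M A = 0 \<and> emeasure N (space N - A) = 0)"

lemma space_boundary [simp]: "space (boundary T r) = rays T r"
  unfolding boundary_def by (rule space_measure_of) (auto simp: rays_through_def)

lemma rays_through_in_sets:
  assumes "v \<in> pverts T"
  shows "rays_through T r v \<in> sets (boundary T r)"
  unfolding boundary_def using assms
  by (subst sets_measure_of) (auto simp: rays_through_def)

lemma labels_given_ray_measurable:
  fixes \<mu> \<nu> :: "'l pmf"
  assumes [simp]: "sets \<Phi> = sets (boundary T r)"
  shows "labels_given_ray T \<mu> \<nu> \<in> measurable \<Phi> (subprob_algebra (iid_labels T \<mu>))"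
proof -
  let ?V = "pverts T"
  let ?N = "\<lambda>_::'a. measure_pmf \<mu>"
  let ?K = "\<lambda>\<xi> v. measure_pmf (if v \<in> range \<xi> then \<nu> else \<mu>)"
  have sp: "space \<Phi> = rays T r"
    using sets_eq_imp_space_eq[OF assms] by simp
  have P: "product_prob_space (?K \<xi>)" for \<xi> :: "nat \<Rightarrow> 'a"
    by unfold_locales
  show ?thesis
  proof (rule measurable_subprob_algebra_generated)
    show "sets (iid_labels T \<mu>) =
        sigma_sets (\<Pi>\<^sub>E i\<in>?V. space (?N i)) (prod_algebra ?V ?N)"
      by (simp add: iid_labels_def sets_PiM)
    show "Int_stable (prod_algebra ?V ?N)" by (rule Int_stable_prod_algebra)
    show "prod_algebra ?V ?N \<subseteq> Pow (\<Pi>\<^sub>E i\<in>?V. space (?N i))"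
      by (rule prod_algebra_sets_into_space)
    have pr: "prob_space (labels_given_ray T \<mu> \<nu> \<xi>)" for \<xi>
      unfolding labels_given_ray_def by (rule prob_space_PiM) (rule prob_space_measure_pmf)
    then show "subprob_space (labels_given_ray T \<mu> \<nu> \<xi>)" for \<xi>
      by (rule prob_space_imp_subprob_space)
    show "sets (labels_given_ray T \<mu> \<nu> \<xi>) = sets (iid_labels T \<mu>)" for \<xi>
      unfolding labels_given_ray_def iid_labels_def by (rule sets_PiM_cong) auto
    have "space (labels_given_ray T \<mu> \<nu> \<xi>) = (\<Pi>\<^sub>E i\<in>?V. space (?N i))" for \<xi>
      by (auto simp: labels_given_ray_def space_PiM)
    then have "emeasure (labels_given_ray T \<mu> \<nu> \<xi>) (\<Pi>\<^sub>E i\<in>?V. space (?N i)) = 1" for \<xi>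
      using prob_space.emeasure_space_1[OF pr] by metis
    then show "(\<lambda>\<xi>. emeasure (labels_given_ray T \<mu> \<nu> \<xi>) (\<Pi>\<^sub>E i\<in>?V. space (?N i)))
        \<in> borel_measurable \<Phi>"
      by simp
    fix A assume "A \<in> prod_algebra ?V ?N"
    then obtain J E where A: "A = prod_emb ?V ?N J (\<Pi>\<^sub>E j\<in>J. E j)"
      and J: "finite J" "J \<subseteq> ?V"
      by (rule prod_algebraE)
    have eq: "emeasure (labels_given_ray T \<mu> \<nu> \<xi>) A =
        (\<Prod>j\<in>J. if \<xi> \<in> rays_through T r j then emeasure \<nu> (E j) else emeasure \<mu> (E j))"
      if "\<xi> \<in> space \<Phi>" for \<xi>
    proof -
      have "A = prod_emb ?V (?K \<xi>) J (\<Pi>\<^sub>E j\<in>J. E j)"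
        by (simp add: A prod_emb_def)
      then have "emeasure (labels_given_ray T \<mu> \<nu> \<xi>) A = (\<Prod>j\<in>J. emeasure (?K \<xi> j) (E j))"
        unfolding labels_given_ray_def
        using product_prob_space.emeasure_PiM_emb[OF P, of J ?V E \<xi>] J by simp
      also have "\<dots> = (\<Prod>j\<in>J. if \<xi> \<in> rays_through T r j
          then emeasure \<nu> (E j) else emeasure \<mu> (E j))"
        using that sp by (intro prod.cong) (auto simp: rays_through_def)
      finally show ?thesis .
    qed
    have "(\<lambda>\<xi>. \<Prod>j\<in>J. if \<xi> \<in> rays_through T r j then emeasure \<nu> (E j) else emeasure \<mu> (E j))
        \<in> borel_measurable \<Phi>"
    proof (intro borel_measurable_prod_ennreal measurable_If_set measurable_const)
      fix j assume "j \<in> J"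
      then have "rays_through T r j \<in> sets \<Phi>"
        using rays_through_in_sets[of j T r] J by auto
      then show "rays_through T r j \<inter> space \<Phi> \<in> sets \<Phi>"
        by (rule sets.Int) (rule sets.top)
    qed auto
    then show "(\<lambda>\<xi>. emeasure (labels_given_ray T \<mu> \<nu> \<xi>) A) \<in> borel_measurable \<Phi>"
      by (subst measurable_cong[OF eq])
  qed
qed

lemma emeasure_hidden_ray_labels:
  assumes "sets \<Phi> = sets (boundary T r)" "prob_space \<Phi>" "A \<in> sets (iid_labels T \<mu>)"
  shows "emeasure (hidden_ray_labels T \<mu> \<nu> \<Phi>) A =
    (\<integral>\<^sup>+\<xi>. emeasure (labels_given_ray T \<mu> \<nu> \<xi>) A \<partial>\<Phi>)"
  unfolding hidden_ray_labels_def
  using assms labels_given_ray_measurable[OF assms(1)] prob_space.not_empty[OF assms(2)]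
  by (intro emeasure_bind)

end

theory Submission
  imports Defs
begin

text \<open>Write \<open>H\<close> for the relative entropy. Given the hidden ray \<open>\<xi>\<close>, the labels of its first \<open>n + 1\<close> vertices have
likelihood ratio \<open>lik (\<xi> n)\<close>, a product of factors \<open>\<nu> / \<mu>\<close>, and the strong law of large numbers says that
\<open>lik (\<xi> n)\<close> grows like \<open>exp (n H)\<close> under the planted law. The vertex \<open>\<xi> n\<close> enters the likelihood ratio of
the mixture with weight \<open>\<Psi> (\<xi> n)\<close>, so everything depends on the product \<open>\<Psi> (\<xi> n) * lik (\<xi> n)\<close>. If the
local dimension at \<open>\<xi>\<close> is larger than \<open>H\<close>, this product decays exponentially; if it is smaller than \<open>H\<close>,
the product is exponentially large for infinitely many \<open>n\<close>.

Below \<open>H\<close>: under the product measure \<open>P\<close> every \<open>lik v\<close> has mean one, so that the sum of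
\<open>exp (- \<delta> n) * \<Psi> v * lik v\<close> over all levels \<open>n\<close> and all vertices \<open>v\<close> of level \<open>n\<close> has finite mean and is
almost surely finite (\<open>weighted_lik_finite\<close>). Under the planted law the terms on the hidden ray
alone make it infinite when \<open>\<delta>\<close> is small (\<open>weighted_lik_infinite\<close>). This event separates the two measures.

Above \<open>H\<close>: absolute continuity with respect to \<open>P\<close> follows from a truncated second moment argument on a
finite set \<open>F\<close> of vertices that contains all ancestors of its elements. Two rays of a tree share an
initial segment and never meet again (\<open>rays_meet\<close>), and off \<open>\<xi>\<close> all factors \<open>\<nu> / \<mu>\<close> average to one.
So, given the labels on the hidden ray \<open>\<xi>\<close>, the likelihood ratio of the mixture on \<open>F\<close> has mean at most
a constant times the sum of \<open>\<Psi> (\<xi> n) * lik (\<xi> n)\<close> over all \<open>n\<close>, which is almost surely finite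
(\<open>ray_lik_finite\<close>). Where that sum is at most \<open>K\<close>, Markov's inequality gives a bound that does not
depend on \<open>F\<close> (\<open>truncated_second_moment\<close>, \<open>mixture_cylinder_bound\<close>), hence the epsilon-delta form of
absolute continuity on cylinder events, and approximation by cylinders extends it to null sets.

In the opposite direction, let \<open>Z\<close> be the set where the density of the mixture with respect to \<open>P\<close>
vanishes. All label probabilities are positive, so the preimage of a null set of the mixture under a
change of one label is again a null set, and \<open>Z\<close> is invariant under such changes up to \<open>P\<close>-null
sets. A zero-one law (\<open>zero_one_coordinate_changes\<close>) leaves \<open>P Z = 0\<close> or \<open>P Z = 1\<close>, and the second is
impossible for the density of a probability measure.

Vertices may have infinite, even uncountable degree. Only countably many vertices of each level
have positive \<open>\<Psi>\<close>-mass (\<open>countable_heavy\<close>), and a level is summed over these only; this is what keeps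
the sums measurable.\<close>

section \<open>Rays of a tree\<close>

lemma pcas_append: "pcas u p v \<Longrightarrow> pcas v q w \<Longrightarrow> pcas u (p @ q) w"
  by (induction p arbitrary: u) auto

lemma pcas_forward:
  "a \<le> b \<Longrightarrow> pcas (\<xi> a) (map (\<lambda>i. (\<xi> i, \<xi> (Suc i))) [a..<b]) (\<xi> b)"
proof (induction b rule: dec_induct)
  case (step n)
  have "pcas (\<xi> n) [(\<xi> n, \<xi> (Suc n))] (\<xi> (Suc n))" by simp
  from pcas_append[OF step.IH this] show ?case using step.hyps by simp
qed simp

lemma pcas_backward:
  "a \<le> b \<Longrightarrow> pcas (\<xi> b) (map (\<lambda>i. (\<xi> (Suc i), \<xi> i)) (rev [a..<b])) (\<xi> a)"
  by (induction b rule: dec_induct) auto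

text \<open>Otherwise follow \<open>\<xi>\<close> from the vertex of divergence to the first vertex that also lies on the later
part of \<open>\<zeta>\<close>, and return along \<open>\<zeta>\<close>. This closed walk is a cycle, and it has at least three arcs: with
only two, both rays would have taken the same step out of the vertex of divergence.\<close>

lemma no_meeting_after_divergence:
  assumes T: "undirected_tree T" and \<xi>: "\<xi> \<in> rays T r" and \<zeta>: "\<zeta> \<in> rays T r"
    and a: "\<xi> a = \<zeta> a" "\<xi> (Suc a) \<noteq> \<zeta> (Suc a)"
    and "a < k" "a < j"
  shows "\<xi> k \<noteq> \<zeta> j"
proof
  assume eq: "\<xi> k = \<zeta> j"
  from T interpret pair_bidirected_digraph T by (simp add: undirected_tree_def)
  define K where "K = (LEAST k. a < k \<and> (\<exists>j>a. \<xi> k = \<zeta> j))"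
  have "a < K \<and> (\<exists>j>a. \<xi> K = \<zeta> j)"
    unfolding K_def by (rule LeastI) (use assms eq in blast)
  then obtain J where K: "a < K" "a < J" "\<xi> K = \<zeta> J" by blast
  have least: "\<xi> i \<noteq> \<zeta> l" if "a < i" "i < K" "a < l" for i l
    using not_less_Least[of i "\<lambda>k. a < k \<and> (\<exists>j>a. \<xi> k = \<zeta> j)"] that unfolding K_def by blast
  have inj: "\<xi> i = \<xi> l \<longleftrightarrow> i = l" "\<zeta> i = \<zeta> l \<longleftrightarrow> i = l" for i l
    using \<xi> \<zeta> by (auto simp: rays_def inj_eq)
  have arc: "(\<xi> i, \<xi> (Suc i)) \<in> parcs T" "(\<zeta> i, \<zeta> (Suc i)) \<in> parcs T" for i
    using \<xi> \<zeta> by (auto simp: rays_def)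
  have arc': "(\<zeta> (Suc i), \<zeta> i) \<in> parcs T" for i
    using arc(2) pair_sym_arcs by (auto simp: symmetric_def dest: symD)
  define p where "p = map (\<lambda>i. (\<xi> i, \<xi> (Suc i))) [a..<K] @
    map (\<lambda>i. (\<zeta> (Suc i), \<zeta> i)) (rev [a..<J])"
  have "pcas (\<xi> a) p (\<zeta> a)"
    unfolding p_def
    by (rule pcas_append[OF pcas_forward]) (use K pcas_backward[of a J \<zeta>] in auto)
  then have cas: "pcas (\<xi> a) p (\<xi> a)" using a by simp
  have "set p \<subseteq> parcs T" using arc arc' by (auto simp: p_def)
  moreover have "\<xi> a \<in> pverts T" using arc in_arcsD1 by blast
  ultimately have walk: "awalk (\<xi> a) p (\<xi> a)" using cas by (simp add: awalk_def)
  have "p \<noteq> []" using K by (simp add: p_def)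
  then have "tl (pawalk_verts (\<xi> a) p) = map snd p"
    using awalk_verts_conv'[OF cas] by simp
  also have "\<dots> = map (\<lambda>i. \<xi> (Suc i)) [a..<K] @ map \<zeta> (rev [a..<J])"
    by (simp add: p_def comp_def)
  also have "distinct \<dots>"
  proof -
    have "\<xi> (Suc i) \<noteq> \<zeta> l" if "a \<le> i" "i < K" "a \<le> l" "l < J" for i l
    proof (cases "l = a")
      case True
      then show ?thesis using a(1) that inj(1)[of "Suc i" a] by auto
    next
      case False
      then show ?thesis
        using least[of "Suc i" l] that K inj(2)[of J l] by (cases "Suc i = K") auto
    qed
    then show ?thesis
      using inj by (auto simp: distinct_map inj_on_def distinct_rev)
  qed
  finally have "cycle p" using walk \<open>p \<noteq> []\<close> unfolding cycle_def by auto
  moreover have "3 \<le> length p"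
  proof (rule ccontr)
    assume "\<not> 3 \<le> length p"
    then have "K = Suc a" "J = Suc a" using K by (auto simp: p_def)
    then show False using K(3) a(2) by simp
  qed
  ultimately show False using T by (auto simp: undirected_tree_def)
qed

text \<open>The absence of cycles enters the later arguments only in this form: a vertex determines its distance
from the root and the path that every ray takes to it.\<close>

lemma rays_meet:
  assumes T: "undirected_tree T" and \<xi>: "\<xi> \<in> rays T r" and \<zeta>: "\<zeta> \<in> rays T r"
    and eq: "\<xi> k = \<zeta> j"
  shows "k = j \<and> (\<forall>i\<le>k. \<xi> i = \<zeta> i)"
proof -
  have inj: "\<xi> i = \<xi> l \<longleftrightarrow> i = l" "\<zeta> i = \<zeta> l \<longleftrightarrow> i = l" for i l
    using \<xi> \<zeta> by (auto simp: rays_def inj_eq)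
  have agree: "\<xi> i = \<zeta> i" if "i \<le> k" "i \<le> j" for i
    using that
  proof (induction i)
    case 0
    then show ?case using \<xi> \<zeta> by (simp add: rays_def)
  next
    case (Suc i)
    then show ?case using no_meeting_after_divergence[OF T \<xi> \<zeta>, of i k j] eq by fastforce
  qed
  have "k = j"
    using agree[of k] agree[of j] eq inj by (metis nle_le)
  then show ?thesis using agree by simp
qed

lemma ray_in_pverts:
  assumes "undirected_tree T" "\<xi> \<in> rays T r" shows "\<xi> n \<in> pverts T"
proof -
  from assms interpret pair_bidirected_digraph T by (simp add: undirected_tree_def)
  show ?thesis using assms in_arcsD1[of "\<xi> n" "\<xi> (Suc n)"] by (auto simp: rays_def)
qed

section \<open>Independent labels and the strong law along a path\<close>

abbreviation label_law :: "'v set \<Rightarrow> ('v \<Rightarrow> 'l pmf) \<Rightarrow> ('v \<Rightarrow> 'l) measure" where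
  "label_law I \<kappa> \<equiv> PiM I (\<lambda>v. measure_pmf (\<kappa> v))"

lemma prob_space_label_law: "prob_space (label_law I \<kappa>)"
  by (intro prob_space_PiM prob_space_measure_pmf)

lemma sets_label_law [measurable_cong]: "sets (label_law I \<kappa>) = sets (PiM I (\<lambda>_. count_space UNIV))"
  by (rule sets_PiM_cong) auto

lemma space_label_law: "space (label_law I \<kappa>) = (\<Pi>\<^sub>E v\<in>I. UNIV)"
  by (simp add: space_PiM)

lemma indep_vars_coordinates:
  assumes "I \<noteq> {}"
  shows "prob_space.indep_vars (label_law I \<kappa>) (\<lambda>v. measure_pmf (\<kappa> v)) (\<lambda>v \<sigma>. \<sigma> v) I"
proof -
  interpret prob_space "label_law I \<kappa>" by (rule prob_space_label_law)
  have "distr (label_law I \<kappa>) (label_law I \<kappa>) (\<lambda>\<sigma>. \<lambda>v\<in>I. \<sigma> v) = distr (label_law I \<kappa>) (label_law I \<kappa>) (\<lambda>\<sigma>. \<sigma>)"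
    by (rule distr_cong) (auto simp: space_PiM)
  also have "\<dots> = label_law I \<kappa>" by simp
  also have "\<dots> = (\<Pi>\<^sub>M v\<in>I. distr (label_law I \<kappa>) (measure_pmf (\<kappa> v)) (\<lambda>\<sigma>. \<sigma> v))"
    by (intro PiM_cong refl distr_PiM_component[symmetric] prob_space_measure_pmf)
  finally show ?thesis
    using assms by (subst indep_vars_iff_distr_eq_PiM') auto
qed

text \<open>The summands take finitely many values, so Hoeffding's inequality bounds the probability of a
deviation \<open>\<epsilon> n\<close> by a geometric sequence, and the Borel-Cantelli lemma applies.\<close>

lemma strong_law_iid_labels:
  fixes f :: "'l::finite \<Rightarrow> real"
  shows "AE \<sigma> in label_law (UNIV :: nat set) (\<lambda>_. \<nu>).
    (\<lambda>n. (\<Sum>i<n. f (\<sigma> i)) / real n) \<longlonglongrightarrow> (\<Sum>a\<in>UNIV. pmf \<nu> a * f a)"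
proof -
  let ?M = "label_law (UNIV :: nat set) (\<lambda>_. \<nu>)"
  let ?h = "\<Sum>a\<in>UNIV. pmf \<nu> a * f a"
  interpret prob_space ?M by (rule prob_space_label_law)
  \<comment> \<open>The summand 1 keeps the interval in Hoeffding's inequality nondegenerate.\<close>
  define B where "B = 1 + Max (range (\<lambda>a. \<bar>f a\<bar>))"
  have B: "\<bar>f a\<bar> \<le> B" "0 < B" for a
  proof -
    have *: "\<bar>f a\<bar> \<le> Max (range (\<lambda>a. \<bar>f a\<bar>))" for a by (rule Max_ge) auto
    show "\<bar>f a\<bar> \<le> B" using *[of a] unfolding B_def by linarith
    show "0 < B" using *[of undefined] abs_ge_zero[of "f undefined"] unfolding B_def by linarith
  qed
  have E: "expectation (\<lambda>\<sigma>. f (\<sigma> i)) = ?h" for i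
  proof -
    have "expectation (\<lambda>\<sigma>. f (\<sigma> i)) = integral\<^sup>L (distr ?M (measure_pmf \<nu>) (\<lambda>\<sigma>. \<sigma> i)) f"
      by (rule integral_distr[symmetric]) auto
    also have "\<dots> = integral\<^sup>L (measure_pmf \<nu>) f"
      by (subst distr_PiM_component) (auto intro: prob_space_measure_pmf)
    also have "\<dots> = ?h"
      by (subst integral_measure_pmf_real[of UNIV]) (auto simp: mult.commute)
    finally show ?thesis .
  qed
  have ind: "indep_vars (\<lambda>_. borel) (\<lambda>i \<sigma>. f (\<sigma> i)) I" for I
    by (rule indep_vars_compose2[OF indep_vars_subset[OF indep_vars_coordinates[OF UNIV_not_empty]]]) auto
  have dev: "prob {\<sigma>\<in>space ?M. \<bar>(\<Sum>i<n. f (\<sigma> i)) - real n * ?h\<bar> \<ge> \<epsilon> * real n}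
      \<le> 2 * exp (- (\<epsilon>\<^sup>2 / (2 * B\<^sup>2))) ^ n" if "0 < \<epsilon>" for n \<epsilon>
  proof (cases "n = 0")
    case True
    have "prob A \<le> 2" for A by (rule order_trans[OF prob_le_1]) simp
    then show ?thesis using True by simp
  next
    case False
    interpret Hoeffding_ineq ?M "{..<n}" "\<lambda>i \<sigma>. f (\<sigma> i)" "\<lambda>_. - B" "\<lambda>_. B" "real n * ?h"
    proof unfold_locales
      show "AE x in ?M. f (x i) \<in> {- B..B}" for i
        using B(1) by (intro AE_I2) (auto simp: abs_le_iff minus_le_iff)
    qed (use ind E in auto)
    have "prob {\<sigma>\<in>space ?M. \<bar>(\<Sum>i<n. f (\<sigma> i)) - real n * ?h\<bar> \<ge> \<epsilon> * real n}
        \<le> 2 * exp (- 2 * (\<epsilon> * real n)\<^sup>2 / (\<Sum>i<n. (B - - B)\<^sup>2))"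
      using that False B(2) by (intro Hoeffding_ineq_abs_ge) auto
    also have "- 2 * (\<epsilon> * real n)\<^sup>2 / (\<Sum>i<n. (B - - B)\<^sup>2) = real n * (- (\<epsilon>\<^sup>2 / (2 * B\<^sup>2)))"
      using False B(2) by (simp add: field_simps power2_eq_square)
    finally show ?thesis by (simp only: exp_of_nat_mult)
  qed
  have ev: "AE \<sigma> in ?M. \<forall>\<^sub>F n in sequentially. \<bar>(\<Sum>i<n. f (\<sigma> i)) - real n * ?h\<bar> < \<epsilon> * real n"
    if "0 < \<epsilon>" for \<epsilon>
  proof -
    have "AE \<sigma> in ?M. \<forall>\<^sub>F n in sequentially. \<sigma> \<in> space ?M -
        {\<sigma>\<in>space ?M. \<bar>(\<Sum>i<n. f (\<sigma> i)) - real n * ?h\<bar> \<ge> \<epsilon> * real n}"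
    proof (rule borel_cantelli_AE1)
      show "summable (\<lambda>n. prob {\<sigma>\<in>space ?M. \<bar>(\<Sum>i<n. f (\<sigma> i)) - real n * ?h\<bar> \<ge> \<epsilon> * real n})"
      proof (rule summable_comparison_test')
        show "summable (\<lambda>n. 2 * exp (- (\<epsilon>\<^sup>2 / (2 * B\<^sup>2))) ^ n)"
          using that B(2) by (intro summable_mult summable_geometric) auto
        show "norm (prob {\<sigma>\<in>space ?M. \<bar>(\<Sum>i<n. f (\<sigma> i)) - real n * ?h\<bar> \<ge> \<epsilon> * real n})
            \<le> 2 * exp (- (\<epsilon>\<^sup>2 / (2 * B\<^sup>2))) ^ n" for n
          using dev[OF that, of n] by simp
      qed
    qed (auto simp: emeasure_eq_measure)
    then show ?thesis
      by (rule AE_mp) (intro AE_I2 impI, elim eventually_mono, auto)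
  qed
  have "AE \<sigma> in ?M. \<forall>m. \<forall>\<^sub>F n in sequentially.
      \<bar>(\<Sum>i<n. f (\<sigma> i)) - real n * ?h\<bar> < inverse (real (Suc m)) * real n"
    by (subst AE_all_countable) (intro allI ev, simp)
  then show ?thesis
  proof (rule AE_mp, intro AE_I2 impI)
    fix \<sigma> assume *: "\<forall>m. \<forall>\<^sub>F n in sequentially.
      \<bar>(\<Sum>i<n. f (\<sigma> i)) - real n * ?h\<bar> < inverse (real (Suc m)) * real n"
    show "(\<lambda>n. (\<Sum>i<n. f (\<sigma> i)) / real n) \<longlonglongrightarrow> ?h"
    proof (rule tendstoI)
      fix e :: real assume "0 < e"
      then obtain m where m: "inverse (real (Suc m)) < e" using reals_Archimedean by blast
      from *[rule_format, of m] eventually_gt_at_top[of 0]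
      show "\<forall>\<^sub>F n in sequentially. dist ((\<Sum>i<n. f (\<sigma> i)) / real n) ?h < e"
      proof eventually_elim
        case (elim n)
        have "\<bar>(\<Sum>i<n. f (\<sigma> i)) / real n - ?h\<bar> = \<bar>(\<Sum>i<n. f (\<sigma> i)) - real n * ?h\<bar> / real n"
          using elim(2) by (simp add: field_simps abs_divide[symmetric])
        also have "\<dots> < inverse (real (Suc m))"
          using elim by (subst divide_less_eq) auto
        finally show ?case using m by (simp add: dist_real_def)
      qed
    qed
  qed
qed

text \<open>Read along an injective sequence of vertices, independent labels form an i.i.d. sequence.\<close>

lemma strong_law_along_path:
  fixes f :: "'l::finite \<Rightarrow> real"
  assumes inj: "inj \<xi>" "range \<xi> \<subseteq> V" and \<kappa>: "\<And>n. \<kappa> (\<xi> n) = \<nu>"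
  shows "AE \<sigma> in label_law V \<kappa>.
    (\<lambda>n. (\<Sum>i<n. f (\<sigma> (\<xi> i))) / real n) \<longlonglongrightarrow> (\<Sum>a\<in>UNIV. pmf \<nu> a * f a)"
proof -
  have eq: "distr (label_law V \<kappa>) (label_law UNIV (\<lambda>_. \<nu>)) (\<lambda>\<sigma>. \<lambda>n\<in>UNIV. \<sigma> (\<xi> n)) = label_law UNIV (\<lambda>_. \<nu>)"
    using distr_PiM_reindex[of V "\<lambda>v. measure_pmf (\<kappa> v)" \<xi> UNIV] assms
    by (auto intro: prob_space_measure_pmf)
  have m: "(\<lambda>\<sigma>. \<lambda>n\<in>UNIV. \<sigma> (\<xi> n)) \<in> measurable (label_law V \<kappa>) (label_law UNIV (\<lambda>_. \<nu>))"
    proof (intro measurable_restrict)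
    fix n
    have "(\<lambda>\<sigma>. \<sigma> (\<xi> n)) \<in> measurable (label_law V \<kappa>) (measure_pmf (\<kappa> (\<xi> n)))"
      using inj by (intro measurable_component_singleton) auto
    then show "(\<lambda>\<sigma>. \<sigma> (\<xi> n)) \<in> measurable (label_law V \<kappa>) (measure_pmf \<nu>)"
      by (simp only: \<kappa>)
  qed
  show ?thesis
    using strong_law_iid_labels[of f \<nu>] AE_distrD[OF m, of "\<lambda>\<sigma>. (\<lambda>n. (\<Sum>i<n. f (\<sigma> i)) / real n) \<longlonglongrightarrow> (\<Sum>a\<in>UNIV. pmf \<nu> a * f a)"]
    by (simp only: eq) simp
qed

section \<open>Functions of finitely many labels\<close>

text \<open>The arguments are total functions, not restricted to the extensional ones that form the space of a
product measure, so that a function of the labels in \<open>F\<close> can be evaluated at a configuration on \<open>F\<close>.\<close>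

definition depends_on :: "'v set \<Rightarrow> (('v \<Rightarrow> 'l) \<Rightarrow> 'b) \<Rightarrow> bool" where
  "depends_on F g \<longleftrightarrow> (\<forall>\<sigma> \<sigma>'. (\<forall>v\<in>F. \<sigma> v = \<sigma>' v) \<longrightarrow> g \<sigma> = g \<sigma>')"

lemma depends_onD: "depends_on F g \<Longrightarrow> (\<And>v. v \<in> F \<Longrightarrow> \<sigma> v = \<sigma>' v) \<Longrightarrow> g \<sigma> = g \<sigma>'"
  by (auto simp: depends_on_def)

lemma depends_on_mono: "depends_on F g \<Longrightarrow> F \<subseteq> G \<Longrightarrow> depends_on G g"
  unfolding depends_on_def by blast

lemma depends_on_compose2:
  fixes f :: "('v \<Rightarrow> 'l) \<Rightarrow> 'a"
  assumes "depends_on F f" "depends_on F g"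
  shows "depends_on F (\<lambda>\<sigma>. h (f \<sigma>) (g \<sigma>))"
  unfolding depends_on_def
proof (intro allI impI)
  fix \<sigma> \<sigma>' :: "'v \<Rightarrow> 'l" assume "\<forall>v\<in>F. \<sigma> v = \<sigma>' v"
  then have "f \<sigma> = f \<sigma>'" "g \<sigma> = g \<sigma>'" using assms by (blast dest: depends_onD)+
  then show "h (f \<sigma>) (g \<sigma>) = h (f \<sigma>') (g \<sigma>')" by simp
qed

lemma depends_on_compose: "depends_on F f \<Longrightarrow> depends_on F (\<lambda>\<sigma>. h (f \<sigma>))"
  by (rule depends_on_compose2[where h = "\<lambda>x _. h x"])

lemma depends_on_prod:
  fixes f :: "'v \<Rightarrow> 'l \<Rightarrow> 'a::comm_monoid_mult"
  assumes "\<And>v. v \<in> F \<Longrightarrow> v \<in> G \<or> (\<forall>a b. f v a = f v b)"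
  shows "depends_on G (\<lambda>\<sigma>. \<Prod>v\<in>F. f v (\<sigma> v))"
  unfolding depends_on_def
proof (intro allI impI prod.cong refl)
  fix \<sigma> \<sigma>' :: "'v \<Rightarrow> 'l" and v assume "\<forall>v\<in>G. \<sigma> v = \<sigma>' v" "v \<in> F"
  then show "f v (\<sigma> v) = f v (\<sigma>' v)" using assms[of v] by metis
qed

definition point_cylinder :: "'v set \<Rightarrow> 'v set \<Rightarrow> ('v \<Rightarrow> 'l) \<Rightarrow> ('v \<Rightarrow> 'l) set" where
  "point_cylinder I F \<tau> = {\<sigma> \<in> (\<Pi>\<^sub>E v\<in>I. UNIV). \<forall>v\<in>F. \<sigma> v = \<tau> v}"

lemma
  assumes "finite F" "F \<subseteq> I"
  shows point_cylinder_in_sets: "point_cylinder I F \<tau> \<in> sets (label_law I \<kappa>)"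
    and emeasure_point_cylinder: "emeasure (label_law I \<kappa>) (point_cylinder I F \<tau>) =
      (\<Prod>v\<in>F. ennreal (pmf (\<kappa> v) (\<tau> v)))"
proof -
  have eq: "point_cylinder I F \<tau> = prod_emb I (\<lambda>v. measure_pmf (\<kappa> v)) F (\<Pi>\<^sub>E v\<in>F. {\<tau> v})"
    using assms by (auto simp: point_cylinder_def prod_emb_def PiE_iff restrict_def extensional_def)
  show "point_cylinder I F \<tau> \<in> sets (label_law I \<kappa>)"
    unfolding eq using assms by (intro sets_PiM_I) auto
  show "emeasure (label_law I \<kappa>) (point_cylinder I F \<tau>) = (\<Prod>v\<in>F. ennreal (pmf (\<kappa> v) (\<tau> v)))"
    unfolding eq using assms by (subst emeasure_PiM_emb) (auto simp: prob_space_measure_pmf emeasure_pmf_single)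
qed

lemma mem_point_cylinder_iff_restrict:
  assumes "\<sigma> \<in> (\<Pi>\<^sub>E v\<in>I. UNIV)" "\<tau> \<in> (\<Pi>\<^sub>E v\<in>F. UNIV)"
  shows "\<sigma> \<in> point_cylinder I F \<tau> \<longleftrightarrow> \<tau> = restrict \<sigma> F"
proof
  assume "\<sigma> \<in> point_cylinder I F \<tau>"
  then show "\<tau> = restrict \<sigma> F"
    using assms(2) by (auto simp: point_cylinder_def PiE_iff extensional_def restrict_def)
qed (use assms in \<open>auto simp: point_cylinder_def\<close>)

lemma
  fixes g :: "('v \<Rightarrow> 'l::finite) \<Rightarrow> ennreal"
  assumes F: "finite F" "F \<subseteq> I" and g: "depends_on F g"
  shows borel_measurable_finite_coords: "g \<in> borel_measurable (label_law I \<kappa>)"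
    and nn_integral_finite_coords: "(\<integral>\<^sup>+\<sigma>. g \<sigma> \<partial>label_law I \<kappa>) =
      (\<Sum>\<tau>\<in>(\<Pi>\<^sub>E v\<in>F. UNIV). g \<tau> * (\<Prod>v\<in>F. ennreal (pmf (\<kappa> v) (\<tau> v))))"
proof -
  let ?L = "label_law I \<kappa>"
  note [measurable] = point_cylinder_in_sets[OF F]
  have fin: "finite (\<Pi>\<^sub>E v\<in>F. UNIV :: 'l set)" using F by (intro finite_PiE) auto
  have eq: "g \<sigma> = (\<Sum>\<tau>\<in>(\<Pi>\<^sub>E v\<in>F. UNIV). g \<tau> * indicator (point_cylinder I F \<tau>) \<sigma>)"
    if "\<sigma> \<in> space ?L" for \<sigma>
  proof -
    have "(\<Sum>\<tau>\<in>(\<Pi>\<^sub>E v\<in>F. UNIV). g \<tau> * indicator (point_cylinder I F \<tau>) \<sigma>) =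
        (\<Sum>\<tau>\<in>(\<Pi>\<^sub>E v\<in>F. UNIV). if \<tau> = restrict \<sigma> F then g \<tau> else 0)"
      using that by (intro sum.cong refl) (auto simp: indicator_def mem_point_cylinder_iff_restrict space_label_law)
    also have "\<dots> = g (restrict \<sigma> F)"
      using fin by (subst sum.delta) auto
    also have "\<dots> = g \<sigma>"
      by (rule depends_onD[OF g]) simp
    finally show ?thesis by simp
  qed
  show "g \<in> borel_measurable ?L"
    by (subst measurable_cong[OF eq]) auto
  have "(\<integral>\<^sup>+\<sigma>. g \<sigma> \<partial>?L) = (\<integral>\<^sup>+\<sigma>. (\<Sum>\<tau>\<in>(\<Pi>\<^sub>E v\<in>F. UNIV). g \<tau> * indicator (point_cylinder I F \<tau>) \<sigma>) \<partial>?L)"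
    by (rule nn_integral_cong) (rule eq)
  also have "\<dots> = (\<Sum>\<tau>\<in>(\<Pi>\<^sub>E v\<in>F. UNIV). \<integral>\<^sup>+\<sigma>. g \<tau> * indicator (point_cylinder I F \<tau>) \<sigma> \<partial>?L)"
    by (rule nn_integral_sum) auto
  also have "\<dots> = (\<Sum>\<tau>\<in>(\<Pi>\<^sub>E v\<in>F. UNIV). g \<tau> * (\<Prod>v\<in>F. ennreal (pmf (\<kappa> v) (\<tau> v))))"
    using F by (intro sum.cong refl) (simp add: nn_integral_cmult emeasure_point_cylinder)
  finally show "(\<integral>\<^sup>+\<sigma>. g \<sigma> \<partial>?L) = \<dots>" .
qed

lemma nn_integral_finite_coords_cong:
  fixes g :: "('v \<Rightarrow> 'l::finite) \<Rightarrow> ennreal"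
  assumes "finite F" "F \<subseteq> I" "depends_on F g" "\<And>v. v \<in> F \<Longrightarrow> \<kappa> v = \<kappa>' v"
  shows "(\<integral>\<^sup>+\<sigma>. g \<sigma> \<partial>label_law I \<kappa>) = (\<integral>\<^sup>+\<sigma>. g \<sigma> \<partial>label_law I \<kappa>')"
  using assms by (simp add: nn_integral_finite_coords)

text \<open>On finitely many coordinates, product laws with positive weights have as density the product of the
ratios of the weights. Stating this for integrals of functions of these coordinates avoids
restricting the measures.\<close>

lemma nn_integral_change_law:
  fixes g :: "('v \<Rightarrow> 'l::finite) \<Rightarrow> ennreal"
  assumes F: "finite F" "F \<subseteq> I" and g: "depends_on F g"
    and pos: "\<And>v a. v \<in> F \<Longrightarrow> 0 < pmf (\<kappa>' v) a"
  shows "(\<integral>\<^sup>+\<sigma>. g \<sigma> \<partial>label_law I \<kappa>) =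
    (\<integral>\<^sup>+\<sigma>. g \<sigma> * ennreal (\<Prod>v\<in>F. pmf (\<kappa> v) (\<sigma> v) / pmf (\<kappa>' v) (\<sigma> v)) \<partial>label_law I \<kappa>')"
proof -
  have "depends_on F (\<lambda>\<sigma>. \<Prod>v\<in>F. pmf (\<kappa> v) (\<sigma> v) / pmf (\<kappa>' v) (\<sigma> v))"
    by (rule depends_on_prod[where f = "\<lambda>v a. pmf (\<kappa> v) a / pmf (\<kappa>' v) a"]) simp
  then have dep: "depends_on F (\<lambda>\<sigma>. g \<sigma> * ennreal (\<Prod>v\<in>F. pmf (\<kappa> v) (\<sigma> v) / pmf (\<kappa>' v) (\<sigma> v)))"
    by (rule depends_on_compose2[OF g, where h = "\<lambda>x y. x * ennreal y"])
  have "ennreal (\<Prod>v\<in>F. pmf (\<kappa> v) (\<tau> v) / pmf (\<kappa>' v) (\<tau> v)) * (\<Prod>v\<in>F. ennreal (pmf (\<kappa>' v) (\<tau> v)))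
      = (\<Prod>v\<in>F. ennreal (pmf (\<kappa> v) (\<tau> v)))" for \<tau>
  proof -
    have "(\<Prod>v\<in>F. pmf (\<kappa> v) (\<tau> v) / pmf (\<kappa>' v) (\<tau> v)) * (\<Prod>v\<in>F. pmf (\<kappa>' v) (\<tau> v))
      = (\<Prod>v\<in>F. pmf (\<kappa> v) (\<tau> v))"
      unfolding prod.distrib[symmetric]
    proof (intro prod.cong refl)
      fix v assume "v \<in> F"
      from pos[OF this, of "\<tau> v"]
      show "pmf (\<kappa> v) (\<tau> v) / pmf (\<kappa>' v) (\<tau> v) * pmf (\<kappa>' v) (\<tau> v) = pmf (\<kappa> v) (\<tau> v)" by simp
    qed
    then show ?thesis
      by (simp add: prod_ennreal ennreal_mult[symmetric] prod_nonneg)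
  qed
  then show ?thesis
    using F g dep by (simp add: nn_integral_finite_coords mult.assoc)
qed

text \<open>The integral over the labels is a finite sum, so the order of integration can be exchanged without
joint measurability of \<open>k\<close>.\<close>

lemma nn_integral_swap_finite_coords:
  fixes k :: "'a \<Rightarrow> ('v \<Rightarrow> 'l::finite) \<Rightarrow> ennreal"
  assumes F: "finite F" "F \<subseteq> I" and dep: "\<And>x. depends_on F (k x)"
    and meas: "\<And>\<tau>. (\<lambda>x. k x \<tau>) \<in> borel_measurable M"
  shows "(\<integral>\<^sup>+x. \<integral>\<^sup>+\<sigma>. k x \<sigma> \<partial>label_law I \<kappa> \<partial>M) = (\<integral>\<^sup>+\<sigma>. \<integral>\<^sup>+x. k x \<sigma> \<partial>M \<partial>label_law I \<kappa>)"
proof -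
  have dep': "depends_on F (\<lambda>\<sigma>. \<integral>\<^sup>+x. k x \<sigma> \<partial>M)"
    unfolding depends_on_def by (intro allI impI nn_integral_cong) (rule depends_onD[OF dep], auto)
  show ?thesis
    unfolding nn_integral_finite_coords[OF F dep] nn_integral_finite_coords[OF F dep']
    using meas by (subst nn_integral_sum) (auto simp: nn_integral_multc)
qed

section \<open>Cylinder events and absolute continuity\<close>

text \<open>The sets that can be approximated by elements of the algebra form a sigma-algebra; for a countable
union, cut off the tail and approximate the remaining finitely many sets. The two measures are
treated together because the approximating set must serve both of them at once.\<close>

lemma approx_by_algebra:
  assumes fin: "finite_measure M" "finite_measure N" and \<A>: "algebra \<Omega> \<A>"
    and sets: "sets M = sigma_sets \<Omega> \<A>" "sets N = sigma_sets \<Omega> \<A>"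
    and A: "A \<in> sigma_sets \<Omega> \<A>" and e: "0 < (e::real)"
  shows "\<exists>B\<in>\<A>. measure M (sym_diff A B) < e \<and> measure N (sym_diff A B) < e"
  using A e
proof (induction arbitrary: e)
  case (Basic a)
  then show ?case by (intro bexI[of _ a]) auto
next
  case Empty
  interpret algebra \<Omega> \<A> by fact
  show ?case using Empty by (intro bexI[of _ "{}"]) auto
next
  case (Compl a)
  interpret algebra \<Omega> \<A> by fact
  from Compl.IH[OF Compl.prems] obtain B where B: "B \<in> \<A>"
    "measure M (sym_diff a B) < e" "measure N (sym_diff a B) < e" by blast
  have "a \<subseteq> \<Omega>" "B \<subseteq> \<Omega>"
    using Compl.hyps sigma_sets_into_sp[OF space_closed] B(1) sets_into_space by blast+
  then have "sym_diff (\<Omega> - a) (\<Omega> - B) = sym_diff a B" by blast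
  then show ?case using B by (intro bexI[of _ "\<Omega> - B"]) auto
next
  case (Union a)
  interpret algebra \<Omega> \<A> by fact
  have as [measurable]: "a i \<in> sets M" "a i \<in> sets N" for i using Union.hyps sets by auto
  have tail: "\<exists>n0. \<forall>n\<ge>n0. measure L (\<Union>(range a) - (\<Union>i<n. a i)) < e / 2"
    if "finite_measure L" "\<And>i. a i \<in> sets L" for L
  proof -
    interpret finite_measure L by fact
    have [measurable]: "a i \<in> sets L" for i by fact
    have "(\<lambda>n. measure L (\<Union>(range a) - (\<Union>i<n. a i))) \<longlonglongrightarrow> measure L (\<Inter>n. \<Union>(range a) - (\<Union>i<n. a i))"
      by (intro finite_Lim_measure_decseq) (auto simp: decseq_def)
    also have "(\<Inter>n. \<Union>(range a) - (\<Union>i<n. a i)) = {}" by auto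
    finally have "\<forall>\<^sub>F n in sequentially. measure L (\<Union>(range a) - (\<Union>i<n. a i)) < e / 2"
      using Union.prems by (auto dest!: order_tendstoD(2)[of _ _ _ "e / 2"])
    then show ?thesis by (simp add: eventually_sequentially)
  qed
  from tail[OF fin(1)] tail[OF fin(2)] as obtain n1 n2 where
    "\<forall>n\<ge>n1. measure M (\<Union>(range a) - (\<Union>i<n. a i)) < e / 2"
    "\<forall>n\<ge>n2. measure N (\<Union>(range a) - (\<Union>i<n. a i)) < e / 2" by blast
  then obtain n where n: "measure M (\<Union>(range a) - (\<Union>i<n. a i)) < e / 2"
    "measure N (\<Union>(range a) - (\<Union>i<n. a i)) < e / 2"
    by (meson max.cobounded1 max.cobounded2)
  have "\<exists>B\<in>\<A>. measure M (sym_diff (a i) B) < e / (2 * Suc n) \<and> measure N (sym_diff (a i) B) < e / (2 * Suc n)" for i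
    using Union.prems by (intro Union.IH) auto
  then obtain B where B: "\<And>i. B i \<in> \<A>"
    "\<And>i. measure M (sym_diff (a i) (B i)) < e / (2 * Suc n)"
    "\<And>i. measure N (sym_diff (a i) (B i)) < e / (2 * Suc n)" by metis
  have est: "measure L (sym_diff (\<Union>(range a)) (\<Union>i<n. B i)) < e"
    if L: "finite_measure L" "sets L = sigma_sets \<Omega> \<A>"
      and t: "measure L (\<Union>(range a) - (\<Union>i<n. a i)) < e / 2"
      and b: "\<And>i. measure L (sym_diff (a i) (B i)) < e / (2 * Suc n)" for L
  proof -
    interpret finite_measure L by fact
    have [measurable]: "a i \<in> sets L" "B i \<in> sets L" for i
      using Union.hyps B(1) L by auto
    have "measure L (sym_diff (\<Union>(range a)) (\<Union>i<n. B i))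
        \<le> measure L ((\<Union>(range a) - (\<Union>i<n. a i)) \<union> (\<Union>i<n. sym_diff (a i) (B i)))"
      by (intro finite_measure_mono) auto
    also have "\<dots> \<le> measure L (\<Union>(range a) - (\<Union>i<n. a i)) + measure L (\<Union>i<n. sym_diff (a i) (B i))"
      by (intro measure_Un_le) auto
    also have "measure L (\<Union>i<n. sym_diff (a i) (B i)) \<le> (\<Sum>i<n. measure L (sym_diff (a i) (B i)))"
      by (intro finite_measure_subadditive_finite) auto
    also have "\<dots> \<le> (\<Sum>i<n. e / (2 * Suc n))"
      using b by (intro sum_mono less_imp_le)
    also have "\<dots> \<le> e / 2" using Union.prems by (simp add: field_simps)
    finally show ?thesis using t by simp
  qed
  show ?case
    using est[OF fin(1) sets(1) n(1) B(2)] est[OF fin(2) sets(2) n(2) B(3)] B(1)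
    by (intro bexI[of _ "\<Union>i<n. B i"]) auto
qed

definition cylinders :: "'v set \<Rightarrow> ('v \<Rightarrow> 'l) set set" where
  "cylinders I = {{\<sigma> \<in> (\<Pi>\<^sub>E v\<in>I. UNIV). P \<sigma>} | P F. finite F \<and> F \<subseteq> I \<and> depends_on F P}"

lemma algebra_cylinders: "algebra (\<Pi>\<^sub>E v\<in>I. UNIV) (cylinders I :: ('v \<Rightarrow> 'l) set set)"
  unfolding algebra_iff_Un
proof (intro conjI ballI)
  let ?S = "\<Pi>\<^sub>E v\<in>I. UNIV :: 'l set"
  show "{} \<in> cylinders I"
    unfolding cylinders_def by (intro CollectI exI[of _ "\<lambda>_. False"] exI[of _ "{}"]) (auto simp: depends_on_def)
  show "cylinders I \<subseteq> Pow ?S" by (auto simp: cylinders_def)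
  fix A :: "('v \<Rightarrow> 'l) set" assume "A \<in> cylinders I"
  then obtain P F where A: "A = {\<sigma> \<in> ?S. P \<sigma>}" "finite F" "F \<subseteq> I" "depends_on F P"
    by (auto simp: cylinders_def)
  have "depends_on F (\<lambda>\<sigma>. \<not> P \<sigma>)" using A(4) by (simp add: depends_on_def)
  then show "?S - A \<in> cylinders I"
    unfolding cylinders_def using A
    by (intro CollectI exI[of _ "\<lambda>\<sigma>. \<not> P \<sigma>"] exI[of _ F]) auto
  fix B :: "('v \<Rightarrow> 'l) set" assume "B \<in> cylinders I"
  then obtain P' F' where B: "B = {\<sigma> \<in> ?S. P' \<sigma>}" "finite F'" "F' \<subseteq> I" "depends_on F' P'"
    by (auto simp: cylinders_def)
  have "depends_on (F \<union> F') (\<lambda>\<sigma>. P \<sigma> \<or> P' \<sigma>)"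
    using A(4) B(4) unfolding depends_on_def by (metis UnCI)
  then show "A \<union> B \<in> cylinders I"
    unfolding cylinders_def using A B
    by (intro CollectI exI[of _ "\<lambda>\<sigma>. P \<sigma> \<or> P' \<sigma>"] exI[of _ "F \<union> F'"]) auto
qed

lemma cylinder_in_sets:
  fixes P :: "('v \<Rightarrow> 'l::finite) \<Rightarrow> bool"
  assumes "finite F" "F \<subseteq> I" "depends_on F P"
  shows "{\<sigma> \<in> (\<Pi>\<^sub>E v\<in>I. UNIV). P \<sigma>} \<in> sets (label_law I \<kappa>)"
proof -
  have "depends_on F (\<lambda>\<sigma>. if P \<sigma> then 1 else 0 :: ennreal)"
    using assms(3) unfolding depends_on_def by metis
  from borel_measurable_finite_coords[OF assms(1,2) this]
  have "(\<lambda>\<sigma>. if P \<sigma> then 1 else 0 :: ennreal) \<in> borel_measurable (label_law I \<kappa>)" .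
  then have "(\<lambda>\<sigma>. if P \<sigma> then 1 else 0 :: ennreal) -` {1} \<inter> space (label_law I \<kappa>) \<in> sets (label_law I \<kappa>)"
    by (rule measurable_sets) auto
  also have "(\<lambda>\<sigma>. if P \<sigma> then 1 else 0 :: ennreal) -` {1} \<inter> space (label_law I \<kappa>)
    = {\<sigma> \<in> (\<Pi>\<^sub>E v\<in>I. UNIV). P \<sigma>}"
    by (auto simp: space_label_law split: if_splits)
  finally show ?thesis .
qed

lemma sets_label_law_cylinders:
  fixes \<kappa> :: "'v \<Rightarrow> 'l::finite pmf"
  shows "sets (label_law I \<kappa>) = sigma_sets (\<Pi>\<^sub>E v\<in>I. UNIV) (cylinders I)"
proof
  show "sigma_sets (\<Pi>\<^sub>E v\<in>I. UNIV) (cylinders I) \<subseteq> sets (label_law I \<kappa>)"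
  proof -
    have "cylinders I \<subseteq> sets (label_law I \<kappa>)"
      unfolding cylinders_def by (auto intro: cylinder_in_sets)
    then show ?thesis
      by (metis sets.sigma_sets_subset space_label_law)
  qed
  have "sets (label_law I \<kappa>) = sigma_sets (\<Pi>\<^sub>E v\<in>I. UNIV) {{f \<in> (\<Pi>\<^sub>E v\<in>I. UNIV). f v \<in> A} | v A. v \<in> I}"
    by (subst sets_PiM_single) simp
  also have "\<dots> \<subseteq> sigma_sets (\<Pi>\<^sub>E v\<in>I. UNIV) (cylinders I)"
  proof (rule sigma_sets_mono, safe)
    fix v and A :: "'l set" assume "v \<in> I"
    then have "{f \<in> (\<Pi>\<^sub>E v\<in>I. UNIV). f v \<in> A} \<in> cylinders I"
      unfolding cylinders_def
      by (intro CollectI exI[of _ "\<lambda>f. f v \<in> A"] exI[of _ "{v}"]) (auto simp: depends_on_def)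
    then show "{f \<in> (\<Pi>\<^sub>E v\<in>I. UNIV). f v \<in> A} \<in> sigma_sets (\<Pi>\<^sub>E v\<in>I. UNIV) (cylinders I)" ..
  qed
  finally show "sets (label_law I \<kappa>) \<subseteq> \<dots>" .
qed

lemma emeasure_cylinder:
  fixes R :: "('v \<Rightarrow> 'l::finite) \<Rightarrow> bool"
  assumes "finite F" "F \<subseteq> I" "depends_on F R"
  shows "emeasure (label_law I \<kappa>) {\<sigma> \<in> (\<Pi>\<^sub>E v\<in>I. UNIV). R \<sigma>} = (\<integral>\<^sup>+\<sigma>. of_bool (R \<sigma>) \<partial>label_law I \<kappa>)"
proof -
  have "emeasure (label_law I \<kappa>) {\<sigma> \<in> (\<Pi>\<^sub>E v\<in>I. UNIV). R \<sigma>} =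
      (\<integral>\<^sup>+\<sigma>. indicator {\<sigma> \<in> (\<Pi>\<^sub>E v\<in>I. UNIV). R \<sigma>} \<sigma> \<partial>label_law I \<kappa>)"
    by (rule nn_integral_indicator[symmetric]) (rule cylinder_in_sets[OF assms])
  also have "\<dots> = (\<integral>\<^sup>+\<sigma>. of_bool (R \<sigma>) \<partial>label_law I \<kappa>)"
    by (intro nn_integral_cong) (simp add: indicator_def space_label_law)
  finally show ?thesis .
qed

section \<open>Changing one label and the zero-one law\<close>

text \<open>Resampling the label of \<open>v\<close> independently does not change the product law, and the event says that
the new label is \<open>t\<close>.\<close>

lemma emeasure_fix_coordinate:
  fixes \<kappa> :: "'v \<Rightarrow> 'l pmf"
  assumes v: "v \<in> I" and N: "N \<in> sets (label_law I \<kappa>)"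
  shows "emeasure (label_law I \<kappa>) {\<sigma>\<in>N. \<sigma> v = t} =
    ennreal (pmf (\<kappa> v) t) * emeasure (label_law I \<kappa>) {\<sigma>\<in>space (label_law I \<kappa>). \<sigma>(v := t) \<in> N}"
proof -
  let ?L = "label_law I \<kappa>"
  interpret prob_space ?L by (rule prob_space_label_law)
  have ins: "insert v I = I" using v by auto
  have upd [measurable]: "(\<lambda>(x, \<sigma>). \<sigma>(v := x)) \<in> measurable (measure_pmf (\<kappa> v) \<Otimes>\<^sub>M ?L) ?L"
    using measurable_add_dim[of v I "\<lambda>v. measure_pmf (\<kappa> v)"] unfolding ins
    by (subst measurable_pair_swap_iff) (simp add: case_prod_unfold)
  have set: "{\<sigma>\<in>N. \<sigma> v = t} \<in> sets ?L"
  proof -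
    have "(\<lambda>\<sigma>. \<sigma> v) -` {t} \<inter> space ?L \<in> sets ?L"
      using v by (intro measurable_sets[OF measurable_component_singleton]) auto
    moreover have "{\<sigma>\<in>N. \<sigma> v = t} = N \<inter> ((\<lambda>\<sigma>. \<sigma> v) -` {t} \<inter> space ?L)"
      using sets.sets_into_space[OF N] by auto
    ultimately show ?thesis using N by auto
  qed
  have "emeasure ?L {\<sigma>\<in>N. \<sigma> v = t} =
      emeasure (distr (measure_pmf (\<kappa> v) \<Otimes>\<^sub>M ?L) ?L (\<lambda>(x, \<sigma>). \<sigma>(v := x))) {\<sigma>\<in>N. \<sigma> v = t}"
    using distr_pair_PiM_eq_PiM[of I "\<lambda>v. measure_pmf (\<kappa> v)" v] unfolding ins
    by (simp add: prob_space_measure_pmf)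
  also have "\<dots> = emeasure (measure_pmf (\<kappa> v) \<Otimes>\<^sub>M ?L)
      ((\<lambda>(x, \<sigma>). \<sigma>(v := x)) -` {\<sigma>\<in>N. \<sigma> v = t} \<inter> space (measure_pmf (\<kappa> v) \<Otimes>\<^sub>M ?L))"
    by (rule emeasure_distr[OF upd set])
  also have "\<dots> = (\<integral>\<^sup>+x. emeasure ?L (Pair x -` ((\<lambda>(x, \<sigma>). \<sigma>(v := x)) -` {\<sigma>\<in>N. \<sigma> v = t} \<inter>
      space (measure_pmf (\<kappa> v) \<Otimes>\<^sub>M ?L))) \<partial>measure_pmf (\<kappa> v))"
    by (rule emeasure_pair_measure_alt) (rule measurable_sets[OF upd set])
  also have "\<dots> = (\<integral>\<^sup>+x. emeasure ?L {\<sigma>\<in>space ?L. \<sigma>(v := t) \<in> N} * indicator {t} x \<partial>measure_pmf (\<kappa> v))"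
    by (intro nn_integral_cong)
      (auto simp: space_pair_measure indicator_def intro!: arg_cong[where f = "emeasure ?L"])
  also have "\<dots> = emeasure ?L {\<sigma>\<in>space ?L. \<sigma>(v := t) \<in> N} * ennreal (pmf (\<kappa> v) t)"
    by (simp add: nn_integral_cmult_indicator emeasure_pmf_single)
  finally show ?thesis by (simp add: mult.commute)
qed

lemma measurable_fix_coordinate:
  assumes "v \<in> I"
  shows "(\<lambda>\<sigma>. \<sigma>(v := t)) \<in> measurable (label_law I \<kappa>) (label_law I \<kappa>)"
proof -
  show ?thesis
  proof (rule measurable_PiM_single')
    show "(\<lambda>\<sigma>. \<sigma>(v := t)) \<in> space (label_law I \<kappa>) \<rightarrow> (\<Pi>\<^sub>E w\<in>I. space (measure_pmf (\<kappa> w)))"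
      using assms by (auto simp: space_PiM PiE_iff extensional_def)
    fix w assume "w \<in> I"
    then show "(\<lambda>\<sigma>. (\<sigma>(v := t)) w) \<in> measurable (label_law I \<kappa>) (measure_pmf (\<kappa> w))"
      by (cases "w = v") (auto intro!: measurable_component_singleton)
  qed
qed

text \<open>An almost surely invariant event satisfies \<open>P (N \<inter> B) \<le> P N * P B\<close> for all cylinders \<open>B\<close>: it suffices to
take \<open>B\<close> to fix finitely many labels, and these are released one at a time by
\<open>emeasure_fix_coordinate\<close>. Approximating \<open>N\<close> itself by cylinders gives \<open>P N \<le> (P N)\<^sup>2\<close>.\<close>

lemma zero_one_coordinate_changes:
  fixes \<kappa> :: "'v \<Rightarrow> 'l::finite pmf"
  assumes N: "N \<in> sets (label_law I \<kappa>)"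
    and inv: "\<And>v t. v \<in> I \<Longrightarrow> AE \<sigma> in label_law I \<kappa>. \<sigma>(v := t) \<in> N \<longrightarrow> \<sigma> \<in> N"
  shows "measure (label_law I \<kappa>) N = 0 \<or> measure (label_law I \<kappa>) N = 1"
proof -
  let ?L = "label_law I \<kappa>"
  interpret prob_space ?L by (rule prob_space_label_law)
  have sp: "N \<subseteq> space ?L" using sets.sets_into_space[OF N] .
  have pt: "N \<inter> point_cylinder I F \<tau> \<in> sets ?L" if "finite F" "F \<subseteq> I" for F \<tau>
    using N point_cylinder_in_sets[OF that] by auto
  have point: "emeasure ?L (N \<inter> point_cylinder I F \<tau>) \<le> emeasure ?L N * (\<Prod>v\<in>F. ennreal (pmf (\<kappa> v) (\<tau> v)))"
    if "finite F" "F \<subseteq> I" for F \<tau>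
    using that
  proof (induction F)
    case empty
    then show ?case by (auto intro!: emeasure_mono N)
  next
    case (insert v F)
    have v: "v \<in> I" and F: "finite F" "F \<subseteq> I" using insert by auto
    have "N \<inter> point_cylinder I (insert v F) \<tau> = {\<sigma> \<in> N \<inter> point_cylinder I F \<tau>. \<sigma> v = \<tau> v}"
      by (auto simp: point_cylinder_def)
    then have "emeasure ?L (N \<inter> point_cylinder I (insert v F) \<tau>) =
        ennreal (pmf (\<kappa> v) (\<tau> v)) * emeasure ?L {\<sigma>\<in>space ?L. \<sigma>(v := \<tau> v) \<in> N \<inter> point_cylinder I F \<tau>}"
      using emeasure_fix_coordinate[OF v pt[OF F]] by simp
    also have "emeasure ?L {\<sigma>\<in>space ?L. \<sigma>(v := \<tau> v) \<in> N \<inter> point_cylinder I F \<tau>}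
        \<le> emeasure ?L (N \<inter> point_cylinder I F \<tau>)"
    proof (rule emeasure_mono_AE)
      show "AE \<sigma> in ?L. \<sigma> \<in> {\<sigma>\<in>space ?L. \<sigma>(v := \<tau> v) \<in> N \<inter> point_cylinder I F \<tau>} \<longrightarrow>
          \<sigma> \<in> N \<inter> point_cylinder I F \<tau>"
        using inv[OF v, of "\<tau> v"]
      proof (rule AE_mp, intro AE_I2 impI)
        fix \<sigma> assume \<sigma>: "\<sigma> \<in> space ?L" "\<sigma>(v := \<tau> v) \<in> N \<longrightarrow> \<sigma> \<in> N"
          "\<sigma> \<in> {\<sigma>\<in>space ?L. \<sigma>(v := \<tau> v) \<in> N \<inter> point_cylinder I F \<tau>}"
        then have "\<forall>w\<in>F. \<sigma> w = \<tau> w"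
          using insert.hyps(2) by (auto simp: point_cylinder_def split: if_splits)
        then show "\<sigma> \<in> N \<inter> point_cylinder I F \<tau>"
          using \<sigma> by (auto simp: point_cylinder_def space_label_law)
      qed
    qed (rule pt[OF F])
    also have "\<dots> \<le> emeasure ?L N * (\<Prod>v\<in>F. ennreal (pmf (\<kappa> v) (\<tau> v)))"
      by (rule insert.IH) fact
    finally show ?case
      using insert.hyps by (simp add: mult_left_mono mult.left_commute mult.assoc)
  qed
  have cyl: "measure ?L (N \<inter> B) \<le> measure ?L N * measure ?L B" if B: "B \<in> cylinders I" for B
  proof -
    from B obtain P F where F: "finite F" "F \<subseteq> I" and dep: "depends_on F P"
      and B_eq: "B = {\<sigma> \<in> (\<Pi>\<^sub>E v\<in>I. UNIV). P \<sigma>}"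
      by (auto simp: cylinders_def)
    define T where "T = {\<tau> \<in> (\<Pi>\<^sub>E v\<in>F. UNIV). P \<tau>}"
    have fin: "finite (\<Pi>\<^sub>E v\<in>F. UNIV :: 'l set)" using F by (intro finite_PiE) auto
    then have T: "finite T" by (simp add: T_def)
    have Pr: "P \<sigma> \<longleftrightarrow> P (restrict \<sigma> F)" for \<sigma>
      using depends_onD[OF dep, of \<sigma> "restrict \<sigma> F"] by simp
    have split: "X \<inter> B = (\<Union>\<tau>\<in>T. X \<inter> point_cylinder I F \<tau>)" for X
    proof (intro equalityI subsetI)
      fix \<sigma> assume "\<sigma> \<in> X \<inter> B"
      then have "restrict \<sigma> F \<in> T" "\<sigma> \<in> X \<inter> point_cylinder I F (restrict \<sigma> F)"
        using Pr by (auto simp: T_def B_eq point_cylinder_def)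
      then show "\<sigma> \<in> (\<Union>\<tau>\<in>T. X \<inter> point_cylinder I F \<tau>)" by blast
    next
      fix \<sigma> assume "\<sigma> \<in> (\<Union>\<tau>\<in>T. X \<inter> point_cylinder I F \<tau>)"
      then obtain \<tau> where \<tau>: "\<tau> \<in> T" "\<sigma> \<in> X" "\<sigma> \<in> point_cylinder I F \<tau>" by auto
      then have "P \<sigma>"
        using depends_onD[OF dep, of \<sigma> \<tau>] by (auto simp: T_def point_cylinder_def)
      then show "\<sigma> \<in> X \<inter> B" using \<tau> by (auto simp: B_eq point_cylinder_def)
    qed
    have disj: "disjoint_family_on (\<lambda>\<tau>. X \<inter> point_cylinder I F \<tau>) T" for X
    unfolding disjoint_family_on_def
    proof (intro ballI impI)
      fix \<tau> \<tau>' assume t: "\<tau> \<in> T" "\<tau>' \<in> T" "\<tau> \<noteq> \<tau>'"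
      have "\<tau> = \<tau>'" if "\<sigma> \<in> point_cylinder I F \<tau>" "\<sigma> \<in> point_cylinder I F \<tau>'" for \<sigma>
        using that t by (intro PiE_ext[of \<tau> F "\<lambda>_. UNIV"]) (auto simp: T_def point_cylinder_def)
      then show "(X \<inter> point_cylinder I F \<tau>) \<inter> (X \<inter> point_cylinder I F \<tau>') = {}" using t by blast
    qed
    have sum: "emeasure ?L (X \<inter> B) = (\<Sum>\<tau>\<in>T. emeasure ?L (X \<inter> point_cylinder I F \<tau>))"
      if "X \<in> sets ?L" for X
      unfolding split using that T disj point_cylinder_in_sets[OF F]
      by (intro sum_emeasure[symmetric]) auto
    have "emeasure ?L (N \<inter> B) \<le> (\<Sum>\<tau>\<in>T. emeasure ?L N * (\<Prod>v\<in>F. ennreal (pmf (\<kappa> v) (\<tau> v))))"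
      unfolding sum[OF N] by (intro sum_mono point F)
    also have "\<dots> = emeasure ?L N * emeasure ?L (space ?L \<inter> B)"
    proof -
      have "space ?L \<inter> point_cylinder I F \<tau> = point_cylinder I F \<tau>" for \<tau>
        by (auto simp: point_cylinder_def space_label_law)
      then show ?thesis
        by (simp add: sum[OF sets.top] emeasure_point_cylinder[OF F] sum_distrib_left)
    qed
    also have "space ?L \<inter> B = B" by (auto simp: B_eq space_label_law)
    finally show ?thesis
      by (simp add: emeasure_eq_measure ennreal_mult[symmetric])
  qed
  \<comment> \<open>Apply the bound for cylinders to a cylinder close to \<open>N\<close>.\<close>
  have "measure ?L N \<le> measure ?L N * measure ?L N"
  proof (rule field_le_epsilon)
    fix e :: real assume "0 < e"
    then have "0 < e / 2" by simp
    have "N \<in> sigma_sets (\<Pi>\<^sub>E v\<in>I. UNIV) (cylinders I)"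
      using N unfolding sets_label_law_cylinders .
    from approx_by_algebra[OF finite_measure_axioms finite_measure_axioms algebra_cylinders
      sets_label_law_cylinders sets_label_law_cylinders this \<open>0 < e / 2\<close>]
    obtain B where B: "B \<in> cylinders I" "measure ?L (sym_diff N B) < e / 2" by blast
    have Bs: "B \<in> sets ?L" unfolding sets_label_law_cylinders using B(1) ..
    have "measure ?L N \<le> measure ?L ((N \<inter> B) \<union> sym_diff N B)"
      using N Bs by (intro finite_measure_mono) auto
    also have "\<dots> \<le> measure ?L (N \<inter> B) + measure ?L (sym_diff N B)"
      using N Bs by (intro measure_Un_le) auto
    also have "\<dots> \<le> measure ?L N * measure ?L B + e / 2"
      using cyl[OF B(1)] B(2) by linarith
    also have "measure ?L B \<le> measure ?L (N \<union> sym_diff N B)"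
      using N Bs by (intro finite_measure_mono) auto
    also have "\<dots> \<le> measure ?L N + measure ?L (sym_diff N B)"
      using N Bs by (intro measure_Un_le) auto
    also have "\<dots> \<le> measure ?L N + e / 2" using B(2) by simp
    also have "measure ?L N * (measure ?L N + e / 2) + e / 2 \<le> measure ?L N * measure ?L N + e"
    proof -
      have "measure ?L N * (e / 2) \<le> 1 * (e / 2)"
        using \<open>0 < e\<close> by (intro mult_right_mono prob_le_1) auto
      then show ?thesis by (simp add: distrib_left)
    qed
    finally show "measure ?L N \<le> measure ?L N * measure ?L N + e"
      by (simp add: mult_left_mono)
  qed
  then show ?thesis
    using prob_le_1[of N] measure_nonneg[of ?L N]
    by (metis antisym_conv1 dual_order.antisym linorder_not_le mult_left_le mult_less_cancel_left2 nle_le)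
qed

text \<open>A null set of the product law is close, for both measures, to a cylinder, which then has small
probability under the product law.\<close>

lemma absolutely_continuous_by_cylinders:
  fixes \<kappa> :: "'v \<Rightarrow> 'l::finite pmf"
  assumes Q: "finite_measure Q" "sets Q = sets (label_law I \<kappa>)"
    and small: "\<And>e. 0 < e \<Longrightarrow> \<exists>\<delta>>0. \<forall>B\<in>cylinders I. measure (label_law I \<kappa>) B < \<delta> \<longrightarrow> measure Q B \<le> e"
  shows "absolutely_continuous (label_law I \<kappa>) Q"
  unfolding absolutely_continuous_def
proof
  let ?L = "label_law I \<kappa>"
  interpret L: prob_space ?L by (rule prob_space_label_law)
  interpret Q: finite_measure Q by fact
  fix N assume "N \<in> null_sets ?L"
  then have N: "N \<in> sets ?L" "measure ?L N = 0" by (auto simp: measure_def)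
  have "measure Q N \<le> 0"
  proof (rule field_le_epsilon)
    fix e :: real assume "0 < e"
    then have "0 < e / 2" by simp
    from small[OF this] obtain \<delta> where \<delta>: "0 < \<delta>"
      "\<And>B. B \<in> cylinders I \<Longrightarrow> measure ?L B < \<delta> \<Longrightarrow> measure Q B \<le> e / 2" by blast
    have "N \<in> sigma_sets (\<Pi>\<^sub>E v\<in>I. UNIV) (cylinders I)" "0 < min \<delta> (e / 2)"
      using N \<open>0 < e\<close> \<delta>(1) by (auto simp: sets_label_law_cylinders)
    from approx_by_algebra[OF L.finite_measure_axioms Q(1) algebra_cylinders
      sets_label_law_cylinders Q(2)[unfolded sets_label_law_cylinders] this]
    obtain B where B: "B \<in> cylinders I" "measure ?L (sym_diff N B) < min \<delta> (e / 2)"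
      "measure Q (sym_diff N B) < min \<delta> (e / 2)" by blast
    have Bs: "B \<in> sets ?L" unfolding sets_label_law_cylinders using B(1) ..
    have "measure ?L B \<le> measure ?L (N \<union> sym_diff N B)"
      using N Bs by (intro L.finite_measure_mono) auto
    also have "\<dots> \<le> measure ?L N + measure ?L (sym_diff N B)"
      using N Bs by (intro measure_Un_le) auto
    finally have "measure Q B \<le> e / 2" using B N by (intro \<delta>) auto
    have "measure Q N \<le> measure Q (B \<union> sym_diff N B)"
      using N Bs Q(2) by (intro Q.finite_measure_mono) auto
    also have "\<dots> \<le> measure Q B + measure Q (sym_diff N B)"
      using N Bs Q(2) by (intro measure_Un_le) auto
    finally show "measure Q N \<le> 0 + e" using \<open>measure Q B \<le> e / 2\<close> B(3) by simp
  qed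
  then have "measure Q N = 0" using measure_nonneg[of Q N] by linarith
  then show "N \<in> null_sets Q"
    using N Q by (auto simp: null_sets_def Q.emeasure_eq_measure)
qed

text \<open>The zero set of the density is invariant under changes of single labels, so that the zero-one law
applies to it. It cannot have full measure, because \<open>Q\<close> has total mass one.\<close>

lemma absolutely_continuous_converse:
  fixes \<kappa> :: "'v \<Rightarrow> 'l::finite pmf"
  assumes Q: "prob_space Q" "sets Q = sets (label_law I \<kappa>)"
    and ac: "absolutely_continuous (label_law I \<kappa>) Q"
    and inv: "\<And>v t N. v \<in> I \<Longrightarrow> N \<in> null_sets Q \<Longrightarrow> {\<sigma>\<in>space Q. \<sigma>(v := t) \<in> N} \<in> null_sets Q"
  shows "absolutely_continuous Q (label_law I \<kappa>)"
proof -
  let ?L = "label_law I \<kappa>"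
  interpret L: prob_space ?L by (rule prob_space_label_law)
  interpret Q: prob_space Q by fact
  define f where "f = RN_deriv ?L Q"
  have f [measurable]: "f \<in> borel_measurable ?L" by (simp add: f_def)
  have dens: "density ?L f = Q"
    unfolding f_def using ac Q(2) by (rule L.density_RN_deriv)
  have null: "N \<in> null_sets Q \<longleftrightarrow> N \<in> sets ?L \<and> (AE \<sigma> in ?L. \<sigma> \<in> N \<longrightarrow> f \<sigma> = 0)" for N
    unfolding dens[symmetric] by (rule null_sets_density_iff) simp
  define Z where "Z = {\<sigma>\<in>space ?L. f \<sigma> = 0}"
  have Z: "Z \<in> sets ?L" unfolding Z_def by measurable
  have "Z \<in> null_sets Q" using Z by (subst null) (auto simp: Z_def)
  have "AE \<sigma> in ?L. \<sigma>(v := t) \<in> Z \<longrightarrow> \<sigma> \<in> Z" if "v \<in> I" for v t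
  proof -
    from inv[OF that \<open>Z \<in> null_sets Q\<close>, of t]
    have "AE \<sigma> in ?L. \<sigma> \<in> {\<sigma>\<in>space Q. \<sigma>(v := t) \<in> Z} \<longrightarrow> f \<sigma> = 0" by (simp add: null)
    then show ?thesis
      by (rule AE_mp) (intro AE_I2, simp add: Z_def sets_eq_imp_space_eq[OF Q(2)])
  qed
  from zero_one_coordinate_changes[OF Z this]
  have "measure ?L Z = 0"
  proof
    assume "measure ?L Z = 1"
    then have "AE \<sigma> in ?L. \<sigma> \<in> Z" using L.prob_eq_1[OF Z] by simp
    then have "AE \<sigma> in ?L. \<sigma> \<in> space ?L \<longrightarrow> f \<sigma> = 0"
      by (rule AE_mp) (intro AE_I2, simp add: Z_def)
    then have "space ?L \<in> null_sets Q" by (simp add: null)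
    then show ?thesis
      using Q.emeasure_space_1 by (simp add: sets_eq_imp_space_eq[OF Q(2)] null_sets_def)
  qed
  then have "AE \<sigma> in ?L. \<sigma> \<notin> Z" using Z by (simp add: AE_iff_null_sets[symmetric] null_sets_def L.emeasure_eq_measure)
  then have pos: "AE \<sigma> in ?L. f \<sigma> \<noteq> 0"
    by (rule AE_mp) (intro AE_I2, simp add: Z_def)
  show ?thesis
    unfolding absolutely_continuous_def
  proof
    fix N assume "N \<in> null_sets Q"
    then have N: "N \<in> sets ?L" "AE \<sigma> in ?L. \<sigma> \<in> N \<longrightarrow> f \<sigma> = 0" by (simp_all add: null)
    from N(2) pos have "AE \<sigma> in ?L. \<sigma> \<notin> N" by eventually_elim auto
    then show "N \<in> null_sets ?L" using N(1) by (simp add: AE_iff_null_sets)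
  qed
qed

section \<open>Likelihood of the labels along a hidden ray\<close>

text \<open>Sums over a countable index set, written as integrals with respect to counting measure.\<close>

lemma borel_measurable_nn_integral_count_space:
  assumes D: "countable D" and g: "\<And>v. v \<in> D \<Longrightarrow> g v \<in> borel_measurable M"
  shows "(\<lambda>x. \<integral>\<^sup>+v. g v x \<partial>count_space D) \<in> borel_measurable M"
proof -
  interpret sigma_finite_measure "count_space D"
    using D by (rule sigma_finite_measure_count_space_countable)
  have "(\<lambda>p. g (fst p) (snd p)) \<in> borel_measurable (count_space D \<Otimes>\<^sub>M M)"
    using D g by (intro measurable_pair_measure_countable1) auto
  then have "(\<lambda>(x, v). g v x) \<in> borel_measurable (M \<Otimes>\<^sub>M count_space D)"
    by (subst measurable_pair_swap_iff) (simp add: case_prod_unfold)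
  then show ?thesis by (rule borel_measurable_nn_integral)
qed

lemma suminf_eq_top_if_frequently_ge_1:
  fixes t :: "nat \<Rightarrow> ennreal"
  assumes "\<exists>\<^sub>F n in sequentially. 1 \<le> t n"
  shows "(\<Sum>n. t n) = \<infinity>"
proof -
  have inf: "infinite {n. 1 \<le> t n}"
    using assms unfolding cofinite_eq_sequentially[symmetric] frequently_cofinite .
  have "of_nat m \<le> (\<Sum>n. t n)" for m
  proof -
    obtain B where B: "B \<subseteq> {n. 1 \<le> t n}" "finite B" "card B = m"
      using infinite_arbitrarily_large[OF inf] by blast
    have "of_nat m = (\<Sum>n\<in>B. 1::ennreal)" using B by simp
    also have "\<dots> \<le> (\<Sum>n\<in>B. t n)" using B by (intro sum_mono) auto
    also have "\<dots> \<le> (\<Sum>n. t n)" using B by (intro sum_le_suminf) auto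
    finally show ?thesis .
  qed
  then show ?thesis
    using ennreal_Ex_less_of_nat[of "\<Sum>n. t n"] by (metis infinity_ennreal_def leD top.not_eq_extremum)
qed

locale hidden_ray =
  fixes T :: "'v pair_pre_digraph" and r :: 'v
    and \<mu> \<nu> :: "'l::finite pmf" and \<Psi> :: "(nat \<Rightarrow> 'v) measure"
  assumes tree: "undirected_tree T"
    and root: "r \<in> pverts T"
    and pos_\<mu>: "\<And>\<omega>. 0 < pmf \<mu> \<omega>" and pos_\<nu>: "\<And>\<omega>. 0 < pmf \<nu> \<omega>"
    and prob_\<Psi>: "prob_space \<Psi>" and sets_\<Psi>: "sets \<Psi> = sets (boundary T r)"
begin

sublocale \<Psi>: prob_space \<Psi> by (rule prob_\<Psi>)

abbreviation V :: "'v set" where "V \<equiv> pverts T"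
abbreviation P :: "('v \<Rightarrow> 'l) measure" where "P \<equiv> label_law V (\<lambda>_. \<mu>)"
abbreviation ray_law :: "(nat \<Rightarrow> 'v) \<Rightarrow> 'v \<Rightarrow> 'l pmf" where
  "ray_law \<xi> \<equiv> \<lambda>v. if v \<in> range \<xi> then \<nu> else \<mu>"
abbreviation P_ray :: "(nat \<Rightarrow> 'v) \<Rightarrow> ('v \<Rightarrow> 'l) measure" where
  "P_ray \<xi> \<equiv> label_law V (ray_law \<xi>)"
abbreviation mass :: "'v \<Rightarrow> real" where "mass v \<equiv> measure \<Psi> (rays_through T r v)"

definition ratio :: "'l \<Rightarrow> real" where "ratio a = pmf \<nu> a / pmf \<mu> a"

text \<open>The vertices between the root and \<open>v\<close>, both included. A vertex that lies on no ray gets the empty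
set; since such vertices never occur on a hidden ray, this value is harmless.\<close>

definition path_to :: "'v \<Rightarrow> 'v set" where
  "path_to v = {u. \<exists>\<xi>\<in>rays T r. \<exists>n. \<xi> n = v \<and> u \<in> \<xi> ` {..n}}"

definition lik :: "'v \<Rightarrow> ('v \<Rightarrow> 'l) \<Rightarrow> real" where
  "lik v \<sigma> = (\<Prod>u\<in>path_to v. ratio (\<sigma> u))"

text \<open>A level of the tree may be uncountable, but only countably many of its vertices have positive mass,
and only these contribute to sums with a factor \<open>mass v\<close>.\<close>

definition heavy :: "nat \<Rightarrow> 'v set" where
  "heavy n = {v. (\<exists>\<xi>\<in>rays T r. \<xi> n = v) \<and> 0 < mass v}"

lemma ratio_pos: "0 < ratio a"
  using pos_\<mu> pos_\<nu> by (simp add: ratio_def)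

lemma lik_pos: "0 < lik v \<sigma>"
  unfolding lik_def by (intro prod_pos ratio_pos)

lemma space_\<Psi>: "space \<Psi> = rays T r"
  using sets_eq_imp_space_eq[OF sets_\<Psi>] by simp

lemma ray_inj: "\<xi> \<in> rays T r \<Longrightarrow> inj \<xi>" unfolding rays_def by blast

lemma ray_in_V: "\<xi> \<in> rays T r \<Longrightarrow> range \<xi> \<subseteq> V"
  using ray_in_pverts[OF tree] by auto

lemma path_to_ray:
  assumes "\<xi> \<in> rays T r" shows "path_to (\<xi> n) = \<xi> ` {..n}"
proof
  show "path_to (\<xi> n) \<subseteq> \<xi> ` {..n}"
  proof
    fix u assume "u \<in> path_to (\<xi> n)"
    then obtain \<zeta> m i where "\<zeta> \<in> rays T r" "\<zeta> m = \<xi> n" "u = \<zeta> i" "i \<le> m"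
      by (auto simp: path_to_def)
    then show "u \<in> \<xi> ` {..n}" using rays_meet[OF tree, of \<zeta> r \<xi> m n] assms by auto
  qed
  show "\<xi> ` {..n} \<subseteq> path_to (\<xi> n)"
    unfolding path_to_def using assms by blast
qed

lemma finite_path_to: "finite (path_to v)"
proof (cases "\<exists>\<xi>\<in>rays T r. \<exists>n. \<xi> n = v")
  case True
  then obtain \<xi> n where "\<xi> \<in> rays T r" "\<xi> n = v" by blast
  then show ?thesis using path_to_ray by fastforce
next
  case False
  then have "path_to v = {}" unfolding path_to_def by blast
  then show ?thesis by simp
qed

lemma path_to_subset: "path_to v \<subseteq> V"
  using ray_in_V by (auto simp: path_to_def)

lemma lik_ray:
  assumes "\<xi> \<in> rays T r" shows "lik (\<xi> n) \<sigma> = (\<Prod>i<Suc n. ratio (\<sigma> (\<xi> i)))"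
  unfolding lik_def path_to_ray[OF assms]
  using inj_on_subset[OF ray_inj[OF assms]] by (subst prod.reindex) (auto simp: lessThan_Suc_atMost)

lemma ln_lik_ray:
  assumes "\<xi> \<in> rays T r" shows "ln (lik (\<xi> n) \<sigma>) = (\<Sum>i<Suc n. ln (ratio (\<sigma> (\<xi> i))))"
  unfolding lik_ray[OF assms] using ratio_pos by (intro ln_prod) (auto simp: less_imp_neq[symmetric])

lemma rays_through_ray:
  assumes "\<xi> \<in> rays T r"
  shows "\<zeta> \<in> rays_through T r (\<xi> n) \<longleftrightarrow> \<zeta> \<in> rays T r \<and> \<zeta> n = \<xi> n"
proof
  assume "\<zeta> \<in> rays_through T r (\<xi> n)"
  then obtain m where \<zeta>: "\<zeta> \<in> rays T r" and m: "\<xi> n = \<zeta> m"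
    unfolding rays_through_def by blast
  from rays_meet[OF tree assms \<zeta> m] m \<zeta> show "\<zeta> \<in> rays T r \<and> \<zeta> n = \<xi> n" by simp
next
  assume \<zeta>: "\<zeta> \<in> rays T r \<and> \<zeta> n = \<xi> n"
  then have "\<xi> n \<in> range \<zeta>" by (metis rangeI)
  with \<zeta> show "\<zeta> \<in> rays_through T r (\<xi> n)" unfolding rays_through_def by blast
qed

lemma rays_through_sets: "v \<in> V \<Longrightarrow> rays_through T r v \<in> sets \<Psi>"
  by (simp only: sets_\<Psi> rays_through_in_sets)

lemma heavy_subset: "heavy n \<subseteq> V"
  using ray_in_V by (auto simp: heavy_def)

lemma disjoint_heavy: "disjoint_family_on (rays_through T r) (heavy n)"
  unfolding disjoint_family_on_def
proof (intro ballI impI)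
  fix v w assume "v \<in> heavy n" "w \<in> heavy n" and ne: "v \<noteq> w"
  then obtain \<xi> \<zeta> where r: "\<xi> \<in> rays T r" "\<zeta> \<in> rays T r" and vw: "v = \<xi> n" "w = \<zeta> n"
    unfolding heavy_def by blast
  show "rays_through T r v \<inter> rays_through T r w = {}"
    using ne unfolding vw by (auto simp: rays_through_ray[OF r(1)] rays_through_ray[OF r(2)])
qed

text \<open>The position of the ray at level \<open>n\<close> is a random vertex, and a finite measure has at most countably
many atoms. The law of this vertex lives on the sigma-algebra generated by the singletons: on all
sets of vertices the position need not be measurable when the level is uncountable.\<close>

lemma countable_heavy: "countable (heavy n)"
proof -
  let ?S = "sigma V ((\<lambda>v. {v}) ` V)"
  have sp: "space ?S = V" by (rule space_measure_of) auto
  have pre: "(\<lambda>\<xi>. \<xi> n) -` {v} \<inter> space \<Psi> = (if \<exists>\<xi>\<in>rays T r. \<xi> n = v then rays_through T r v else {})" for v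
  proof (cases "\<exists>\<xi>\<in>rays T r. \<xi> n = v")
    case True
    then obtain \<xi> where \<xi>: "\<xi> \<in> rays T r" "v = \<xi> n" by blast
    have "(\<lambda>\<xi>. \<xi> n) -` {v} \<inter> rays T r = rays_through T r v"
      unfolding \<xi>(2) by (rule set_eqI) (simp add: rays_through_ray[OF \<xi>(1)] conj_commute)
    then show ?thesis using True by (simp only: space_\<Psi> if_True)
  next
    case False
    then have "(\<lambda>\<xi>. \<xi> n) -` {v} \<inter> rays T r = {}" by blast
    then show ?thesis using False by (simp only: space_\<Psi> if_False)
  qed
  have meas: "(\<lambda>\<xi>. \<xi> n) \<in> measurable \<Psi> ?S"
  proof (rule measurable_measure_of)
    show "(\<lambda>\<xi>. \<xi> n) \<in> space \<Psi> \<rightarrow> V" using ray_in_V space_\<Psi> by auto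
    show "(\<lambda>\<xi>. \<xi> n) -` y \<inter> space \<Psi> \<in> sets \<Psi>" if "y \<in> (\<lambda>v. {v}) ` V" for y
      using that rays_through_sets by (auto simp: pre)
  qed auto
  interpret D: prob_space "distr \<Psi> ?S (\<lambda>\<xi>. \<xi> n)" by (rule \<Psi>.prob_space_distr[OF meas])
  \<comment> \<open>Each heavy vertex is an atom of the law of the vertex at level \<open>n\<close>.\<close>
  have "heavy n \<subseteq> {v. measure (distr \<Psi> ?S (\<lambda>\<xi>. \<xi> n)) {v} \<noteq> 0}"
  proof
    fix v assume v: "v \<in> heavy n"
    then have "v \<in> V" using heavy_subset by auto
    then have "{v} \<in> sets ?S" by (subst sets_measure_of) auto
    then have "measure (distr \<Psi> ?S (\<lambda>\<xi>. \<xi> n)) {v} = mass v"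
      using v by (subst measure_distr[OF meas]) (auto simp: pre heavy_def)
    then show "v \<in> {v. measure (distr \<Psi> ?S (\<lambda>\<xi>. \<xi> n)) {v} \<noteq> 0}"
      using v by (simp add: heavy_def)
  qed
  then show ?thesis by (rule countable_subset) (rule D.countable_support)
qed

lemma sum_mass_heavy_le_1: "(\<integral>\<^sup>+v. ennreal (mass v) \<partial>count_space (heavy n)) \<le> 1"
proof -
  have "(\<integral>\<^sup>+v. ennreal (mass v) \<partial>count_space (heavy n)) =
      (\<integral>\<^sup>+v. emeasure \<Psi> (rays_through T r v) \<partial>count_space (heavy n))"
    by (simp add: \<Psi>.emeasure_eq_measure)
  also have "\<dots> = emeasure \<Psi> (\<Union>v\<in>heavy n. rays_through T r v)"
    by (intro emeasure_UN_countable[symmetric] countable_heavy disjoint_heavy)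
      (rule rays_through_sets, rule subsetD[OF heavy_subset])
  also have "\<dots> \<le> 1" by (rule \<Psi>.measure_le_1)
  finally show ?thesis .
qed

lemma depends_on_lik: "depends_on (path_to v) (\<lambda>\<sigma>. ennreal (lik v \<sigma>))"
  by (auto simp: depends_on_def lik_def intro!: arg_cong[where f = ennreal] prod.cong)

lemma lik_measurable: "(\<lambda>\<sigma>. ennreal (lik v \<sigma>)) \<in> borel_measurable (label_law V \<kappa>)"
  by (rule borel_measurable_finite_coords[OF finite_path_to path_to_subset depends_on_lik])

lemma mass_lik_measurable:
  "(\<lambda>\<sigma>. ennreal c * ennreal (lik v \<sigma>)) \<in> borel_measurable (label_law V \<kappa>)"
  using lik_measurable by measurable

text \<open>Integrating a density: \<open>lik v\<close> is the likelihood ratio on the path to \<open>v\<close> of the law with all labels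
distributed as \<open>\<nu>\<close>.\<close>

lemma nn_integral_lik: "(\<integral>\<^sup>+\<sigma>. ennreal (lik v \<sigma>) \<partial>P) = 1"
proof -
  have "(\<integral>\<^sup>+\<sigma>. 1 \<partial>label_law V (\<lambda>_. \<nu>)) = (\<integral>\<^sup>+\<sigma>. 1 * ennreal (\<Prod>u\<in>path_to v. pmf \<nu> (\<sigma> u) / pmf \<mu> (\<sigma> u)) \<partial>P)"
    by (rule nn_integral_change_law[OF finite_path_to path_to_subset])
      (auto simp: depends_on_def pos_\<mu>)
  then show ?thesis
    using prob_space.emeasure_space_1[OF prob_space_label_law, of V "\<lambda>_. \<nu>"]
    by (simp add: lik_def ratio_def)
qed

lemma lik_growth:
  assumes "\<xi> \<in> rays T r"
  shows "AE \<sigma> in P_ray \<xi>. (\<lambda>n. ln (lik (\<xi> n) \<sigma>) / real (Suc n)) \<longlonglongrightarrow> rel_entropy \<nu> \<mu>"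
proof -
  have "AE \<sigma> in P_ray \<xi>. (\<lambda>n. (\<Sum>i<n. ln (ratio (\<sigma> (\<xi> i)))) / real n)
      \<longlonglongrightarrow> (\<Sum>a\<in>UNIV. pmf \<nu> a * ln (ratio a))"
    using ray_inj[OF assms] ray_in_V[OF assms]
    by (intro strong_law_along_path) auto
  then show ?thesis
  proof (rule AE_mp, intro AE_I2 impI)
    fix \<sigma> assume "(\<lambda>n. (\<Sum>i<n. ln (ratio (\<sigma> (\<xi> i)))) / real n) \<longlonglongrightarrow> (\<Sum>a\<in>UNIV. pmf \<nu> a * ln (ratio a))"
    from LIMSEQ_Suc[OF this]
    show "(\<lambda>n. ln (lik (\<xi> n) \<sigma>) / real (Suc n)) \<longlonglongrightarrow> rel_entropy \<nu> \<mu>"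
      by (simp only: ln_lik_ray[OF assms] rel_entropy_def ratio_def)
  qed
qed

lemma emeasure_mixture:
  assumes "sets \<Phi> = sets (boundary T r)" "prob_space \<Phi>" "A \<in> sets P"
  shows "emeasure (hidden_ray_labels T \<mu> \<nu> \<Phi>) A = (\<integral>\<^sup>+\<xi>. emeasure (P_ray \<xi>) A \<partial>\<Phi>)"
  using emeasure_hidden_ray_labels[OF assms(1,2), of A \<mu> \<nu>] assms(3)
  by (simp add: iid_labels_def labels_given_ray_def)

lemma sets_mixture:
  assumes "sets \<Phi> = sets (boundary T r)" "prob_space \<Phi>"
  shows "sets (hidden_ray_labels T \<mu> \<nu> \<Phi>) = sets P"
  unfolding hidden_ray_labels_def
proof (rule sets_bind)
  show "space \<Phi> \<noteq> {}" using prob_space.not_empty[OF assms(2)] .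
  show "sets (labels_given_ray T \<mu> \<nu> \<xi>) = sets P" for \<xi>
    unfolding labels_given_ray_def by (simp only: sets_label_law)
qed

lemma kernel_measurable:
  assumes "sets \<Phi> = sets (boundary T r)"
  shows "P_ray \<in> measurable \<Phi> (subprob_algebra P)"
  using labels_given_ray_measurable[OF assms, of \<mu> \<nu>]
  by (simp add: iid_labels_def labels_given_ray_def[abs_def])

lemma prob_space_mixture:
  assumes \<Phi>: "sets \<Phi> = sets (boundary T r)" "prob_space \<Phi>"
  shows "prob_space (hidden_ray_labels T \<mu> \<nu> \<Phi>)"
proof
  interpret \<Phi>: prob_space \<Phi> by fact
  have "emeasure (P_ray \<xi>) (space P) = 1" for \<xi>
    using prob_space.emeasure_space_1[OF prob_space_label_law, of V "ray_law \<xi>"] by (simp only: space_label_law)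
  then show "emeasure (hidden_ray_labels T \<mu> \<nu> \<Phi>) (space (hidden_ray_labels T \<mu> \<nu> \<Phi>)) = 1"
    by (simp add: sets_eq_imp_space_eq[OF sets_mixture[OF \<Phi>]] emeasure_mixture[OF \<Phi>] \<Phi>.emeasure_space_1)
qed

section \<open>Singularity below the relative entropy\<close>

definition weighted_lik :: "real \<Rightarrow> ('v \<Rightarrow> 'l) \<Rightarrow> ennreal" where
  "weighted_lik \<delta> \<sigma> =
     (\<Sum>n. \<integral>\<^sup>+v. ennreal (mass v * exp (- \<delta> * real n)) * ennreal (lik v \<sigma>) \<partial>count_space (heavy n))"

lemma weighted_lik_measurable [measurable]: "weighted_lik \<delta> \<in> borel_measurable P"
  unfolding weighted_lik_def
  by (intro borel_measurable_suminf_order borel_measurable_nn_integral_count_space countable_heavy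
      mass_lik_measurable)

text \<open>Since \<open>lik v\<close> has mean one, level \<open>n\<close> contributes at most \<open>exp (- \<delta> n)\<close> to the mean of the sum.\<close>

lemma weighted_lik_finite:
  assumes "0 < \<delta>" shows "AE \<sigma> in P. weighted_lik \<delta> \<sigma> \<noteq> \<infinity>"
proof (rule nn_integral_PInf_AE)
  have "(\<integral>\<^sup>+\<sigma>. weighted_lik \<delta> \<sigma> \<partial>P) = (\<Sum>n. \<integral>\<^sup>+\<sigma>. \<integral>\<^sup>+v. ennreal (mass v * exp (- \<delta> * real n)) *
      ennreal (lik v \<sigma>) \<partial>count_space (heavy n) \<partial>P)"
    unfolding weighted_lik_def
    by (intro nn_integral_suminf borel_measurable_nn_integral_count_space countable_heavy
      mass_lik_measurable)
  also have "\<dots> \<le> (\<Sum>n. ennreal (exp (- \<delta>) ^ n))"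
  proof (rule suminf_le)
    fix n
    have "(\<integral>\<^sup>+\<sigma>. \<integral>\<^sup>+v. ennreal (mass v * exp (- \<delta> * real n)) * ennreal (lik v \<sigma>) \<partial>count_space (heavy n) \<partial>P)
      = (\<integral>\<^sup>+v. \<integral>\<^sup>+\<sigma>. ennreal (mass v * exp (- \<delta> * real n)) * ennreal (lik v \<sigma>) \<partial>P \<partial>count_space (heavy n))"
      by (rule nn_integral_count_space_nn_integral[OF countable_heavy mass_lik_measurable])
    also have "\<dots> = (\<integral>\<^sup>+v. ennreal (mass v) * ennreal (exp (- \<delta> * real n)) \<partial>count_space (heavy n))"
      by (simp add: nn_integral_cmult lik_measurable nn_integral_lik ennreal_mult)
    also have "\<dots> = (\<integral>\<^sup>+v. ennreal (mass v) \<partial>count_space (heavy n)) * ennreal (exp (- \<delta> * real n))"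
      by (rule nn_integral_multc) auto
    also have "\<dots> \<le> 1 * ennreal (exp (- \<delta> * real n))"
      by (intro mult_right_mono sum_mass_heavy_le_1) auto
    also have "\<dots> = ennreal (exp (- \<delta>) ^ n)"
      by (simp add: exp_of_nat_mult[symmetric] mult.commute)
    finally show "(\<integral>\<^sup>+\<sigma>. \<integral>\<^sup>+v. ennreal (mass v * exp (- \<delta> * real n)) * ennreal (lik v \<sigma>) \<partial>count_space (heavy n) \<partial>P)
      \<le> ennreal (exp (- \<delta>) ^ n)" .
  qed auto
  also have "\<dots> < \<infinity>"
    using assms by (subst suminf_ennreal2) (auto intro: summable_geometric)
  finally show "(\<integral>\<^sup>+\<sigma>. weighted_lik \<delta> \<sigma> \<partial>P) \<noteq> \<infinity>" by simp
qed simp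

text \<open>A dimension below \<open>c < H\<close> makes \<open>\<Psi> (\<xi> n) > exp (- c n)\<close> for infinitely many \<open>n\<close>, while \<open>lik (\<xi> n)\<close> is
eventually at least \<open>exp ((n + 1) (H - \<delta>))\<close>. With \<open>3 \<delta> \<le> H - c\<close> the product still beats the weight
\<open>exp (- \<delta> n)\<close>, so the sum has infinitely many terms that are at least one.\<close>

lemma weighted_lik_infinite:
  assumes \<xi>: "\<xi> \<in> rays_dim_below T r \<Psi> (rel_entropy \<nu> \<mu>)"
  shows "AE \<sigma> in P_ray \<xi>. \<exists>m. weighted_lik (inverse (real (Suc m))) \<sigma> = \<infinity>"
proof -
  let ?h = "rel_entropy \<nu> \<mu>"
  have ray: "\<xi> \<in> rays T r" and dim: "local_dim T r \<Psi> \<xi> < ereal ?h"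
    using \<xi> by (auto simp: rays_dim_below_def)
  from ereal_dense2[OF dim] obtain c where c: "local_dim T r \<Psi> \<xi> < ereal c" "c < ?h" by auto
  obtain m where m: "inverse (real (Suc m)) < (?h - c) / 3"
    using reals_Archimedean[of "(?h - c) / 3"] c(2) by auto
  define \<delta> where "\<delta> = inverse (real (Suc m))"
  have \<delta>: "0 < \<delta>" "c \<le> ?h - 3 * \<delta>" using m by (auto simp: \<delta>_def)
  have freq: "\<exists>\<^sub>F n in sequentially. 0 < mass (\<xi> n) \<and> - ln (mass (\<xi> n)) / real n < c"
  proof (rule ccontr)
    assume "\<not> ?thesis"
    then have ev: "\<forall>\<^sub>F n in sequentially. \<not> (0 < mass (\<xi> n) \<and> - ln (mass (\<xi> n)) / real n < c)"
      by (simp add: not_frequently)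
    have "ereal c \<le> local_dim T r \<Psi> \<xi>"
      unfolding local_dim_def
    proof (rule Liminf_bounded, rule eventually_mono[OF ev])
      fix n assume n: "\<not> (0 < mass (\<xi> n) \<and> - ln (mass (\<xi> n)) / real n < c)"
      have "0 \<le> mass (\<xi> n)" by simp
      with n show "ereal c \<le> (let p = mass (\<xi> n) in if p = 0 then \<infinity> else ereal (- ln p / real n))"
        by (cases "mass (\<xi> n) = 0") (auto simp: Let_def)
    qed
    then show False using c(1) by simp
  qed
  show ?thesis
    using lik_growth[OF ray]
  proof (rule AE_mp, intro AE_I2 impI exI[of _ m])
    fix \<sigma> assume lim: "(\<lambda>n. ln (lik (\<xi> n) \<sigma>) / real (Suc n)) \<longlonglongrightarrow> ?h"
    have ev1: "\<forall>\<^sub>F n in sequentially. ?h - \<delta> < ln (lik (\<xi> n) \<sigma>) / real (Suc n)"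
      by (rule order_tendstoD(1)[OF lim]) (use \<delta> in simp)
    obtain N :: nat where N: "(\<delta> - ?h) / \<delta> < real N" using reals_Archimedean2 by blast
    have ev2: "\<forall>\<^sub>F n in sequentially. \<delta> - ?h \<le> \<delta> * real n"
      using eventually_ge_at_top[of N]
    proof eventually_elim
      case (elim n)
      have "(\<delta> - ?h) / \<delta> \<le> real n" using N elim by linarith
      then show ?case using \<delta>(1) by (simp add: divide_le_eq mult.commute)
    qed
    from ev1 ev2 eventually_gt_at_top[of 0]
    have "\<forall>\<^sub>F n in sequentially. 0 < mass (\<xi> n) \<and> - ln (mass (\<xi> n)) / real n < c \<longrightarrow>
      1 \<le> (\<integral>\<^sup>+v. ennreal (mass v * exp (- \<delta> * real n)) * ennreal (lik v \<sigma>) \<partial>count_space (heavy n))"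
    proof eventually_elim
      case (elim n)
      show ?case
      proof
        assume heavy_n: "0 < mass (\<xi> n) \<and> - ln (mass (\<xi> n)) / real n < c"
        let ?v = "\<xi> n"
        have v: "?v \<in> heavy n" using heavy_n ray by (auto simp: heavy_def)
        have "- ln (mass ?v) \<le> c * real n" using elim(3) heavy_n by (simp add: pos_divide_less_eq less_imp_le del: minus_divide_left minus_divide_left[symmetric])
        moreover have "c * real n \<le> (?h - 3 * \<delta>) * real n" using \<delta>(2) by (rule mult_right_mono) simp
        moreover have "(?h - \<delta>) * real (Suc n) < ln (lik ?v \<sigma>)"
          using elim(1) by (simp add: less_divide_eq)
        moreover have "(?h - \<delta>) * real (Suc n) = ?h * real n + ?h - \<delta> * real n - \<delta>"
          by (simp add: algebra_simps)
        moreover have "(?h - 3 * \<delta>) * real n = ?h * real n - 3 * (\<delta> * real n)"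
          by (simp add: algebra_simps)
        ultimately have "0 \<le> ln (mass ?v) + - \<delta> * real n + ln (lik ?v \<sigma>)"
          using elim(2) by linarith
        then have "1 \<le> exp (ln (mass ?v) + - \<delta> * real n + ln (lik ?v \<sigma>))" by simp
        also have "\<dots> = mass ?v * exp (- \<delta> * real n) * lik ?v \<sigma>"
          using heavy_n lik_pos[of ?v \<sigma>] by (simp only: exp_add exp_ln)
        finally have "1 \<le> ennreal (mass ?v * exp (- \<delta> * real n)) * ennreal (lik ?v \<sigma>)"
          using lik_pos by (subst ennreal_mult[symmetric]) (auto simp: less_imp_le)
        also have "\<dots> \<le> (\<integral>\<^sup>+v. ennreal (mass v * exp (- \<delta> * real n)) * ennreal (lik v \<sigma>) \<partial>count_space (heavy n))"
          by (rule nn_integral_ge_point[OF v])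
        finally show "1 \<le> (\<integral>\<^sup>+v. ennreal (mass v * exp (- \<delta> * real n)) * ennreal (lik v \<sigma>) \<partial>count_space (heavy n))" .
      qed
    qed
    with freq have "\<exists>\<^sub>F n in sequentially. 1 \<le> (\<integral>\<^sup>+v. ennreal (mass v * exp (- \<delta> * real n)) * ennreal (lik v \<sigma>) \<partial>count_space (heavy n))"
      by (rule frequently_rev_mp)
    then show "weighted_lik (inverse (real (Suc m))) \<sigma> = \<infinity>"
      unfolding weighted_lik_def \<delta>_def by (rule suminf_eq_top_if_frequently_ge_1)
  qed
qed

lemma mixture_singular:
  assumes \<Phi>: "sets \<Phi> = sets (boundary T r)" "prob_space \<Phi>"
    and below: "AE \<xi> in \<Phi>. \<xi> \<in> rays_dim_below T r \<Psi> (rel_entropy \<nu> \<mu>)"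
  shows "mutually_singular (hidden_ray_labels T \<mu> \<nu> \<Phi>) P"
proof -
  define A where "A = {\<sigma>\<in>space P. \<forall>m. weighted_lik (inverse (real (Suc m))) \<sigma> \<noteq> \<infinity>}"
  have A: "A \<in> sets P" unfolding A_def by measurable
  have "AE \<sigma> in P. \<forall>m. weighted_lik (inverse (real (Suc m))) \<sigma> \<noteq> \<infinity>"
    by (subst AE_all_countable) (intro allI weighted_lik_finite, simp)
  then have "AE \<sigma> in P. \<sigma> \<notin> space P - A"
    by (rule AE_mp) (intro AE_I2, simp add: A_def)
  moreover have C: "space P - A \<in> sets P" using A by (rule sets.compl_sets)
  ultimately have "emeasure P (space P - A) = 0"
    using AE_iff_null_sets[OF C] by (intro null_setsD1) blast
  moreover have "emeasure (hidden_ray_labels T \<mu> \<nu> \<Phi>) A = 0"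
  proof -
    have "AE \<xi> in \<Phi>. emeasure (P_ray \<xi>) A = 0"
      using below
    proof eventually_elim
      case (elim \<xi>)
      from weighted_lik_infinite[OF elim] have "AE \<sigma> in P_ray \<xi>. \<sigma> \<notin> A"
        by (rule AE_mp) (intro AE_I2, auto simp: A_def)
      moreover have "A \<in> sets (P_ray \<xi>)" using A by (simp only: sets_label_law)
      ultimately show ?case by (auto simp: AE_iff_null_sets[symmetric] null_sets_def)
    qed
    then have "(\<integral>\<^sup>+\<xi>. emeasure (P_ray \<xi>) A \<partial>\<Phi>) = (\<integral>\<^sup>+\<xi>. 0 \<partial>\<Phi>)"
      by (rule nn_integral_cong_AE)
    then show ?thesis by (simp add: emeasure_mixture[OF \<Phi> A])
  qed
  ultimately show ?thesis
    unfolding mutually_singular_def using A sets_mixture[OF \<Phi>] by auto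
qed

section \<open>Summability of the likelihood above the relative entropy\<close>

text \<open>Up to a constant this dominates the mean of the likelihood ratio of the mixture, given the hidden
ray \<open>\<xi>\<close> and its labels.\<close>

definition ray_lik :: "(nat \<Rightarrow> 'v) \<Rightarrow> ('v \<Rightarrow> 'l) \<Rightarrow> ennreal" where
  "ray_lik \<xi> \<sigma> = (\<Sum>n. ennreal (mass (\<xi> n)) * ennreal (lik (\<xi> n) \<sigma>))"

text \<open>The label at \<open>\<xi> n\<close> need not be jointly measurable in \<open>\<xi>\<close> and \<open>\<sigma>\<close> when the level is uncountable. The
product with \<open>mass (\<xi> n)\<close> is: it vanishes unless \<open>\<xi> n\<close> is one of the countably many heavy vertices, so it
is a countable sum of products of a function of the ray and a function of the labels.\<close>

lemma ray_lik_measurable: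
  assumes \<Phi>: "sets \<Phi> = sets (boundary T r)"
  shows "(\<lambda>(\<xi>, \<sigma>). ray_lik \<xi> \<sigma>) \<in> borel_measurable (\<Phi> \<Otimes>\<^sub>M P)"
proof -
  have sp: "space \<Phi> = rays T r" using sets_eq_imp_space_eq[OF \<Phi>] by simp
  have eq: "ray_lik \<xi> \<sigma> = (\<Sum>n. \<integral>\<^sup>+v. indicator (rays_through T r v) \<xi> *
      (ennreal (mass v) * ennreal (lik v \<sigma>)) \<partial>count_space (heavy n))"
    if \<xi>: "\<xi> \<in> rays T r" for \<xi> \<sigma>
    unfolding ray_lik_def
  proof (rule arg_cong[where f = suminf], rule ext)
    fix n
    have "(\<integral>\<^sup>+v. indicator (rays_through T r v) \<xi> * (ennreal (mass v) * ennreal (lik v \<sigma>)) \<partial>count_space (heavy n))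
      = (\<integral>\<^sup>+v. (ennreal (mass v) * ennreal (lik v \<sigma>)) * indicator {\<xi> n} v \<partial>count_space (heavy n))"
    proof (rule nn_integral_cong)
      fix v assume "v \<in> space (count_space (heavy n))"
      then obtain \<zeta> where \<zeta>: "\<zeta> \<in> rays T r" "v = \<zeta> n" by (auto simp: heavy_def)
      have "\<xi> \<in> rays_through T r v \<longleftrightarrow> v = \<xi> n"
        using \<xi> unfolding \<zeta>(2) rays_through_ray[OF \<zeta>(1)] by auto
      then show "indicator (rays_through T r v) \<xi> * (ennreal (mass v) * ennreal (lik v \<sigma>)) =
        (ennreal (mass v) * ennreal (lik v \<sigma>)) * indicator {\<xi> n} v"
        by (simp add: indicator_def)
    qed
    also have "\<dots> = ennreal (mass (\<xi> n)) * ennreal (lik (\<xi> n) \<sigma>)"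
    proof (cases "\<xi> n \<in> heavy n")
      case True
      then have "(\<integral>\<^sup>+v. (ennreal (mass v) * ennreal (lik v \<sigma>)) * indicator {\<xi> n} v \<partial>count_space (heavy n))
        = (\<integral>\<^sup>+v. ennreal (mass (\<xi> n)) * ennreal (lik (\<xi> n) \<sigma>) * indicator {\<xi> n} v \<partial>count_space (heavy n))"
        by (intro nn_integral_cong) (simp add: indicator_def)
      also have "\<dots> = ennreal (mass (\<xi> n)) * ennreal (lik (\<xi> n) \<sigma>)"
        using True by (subst nn_integral_cmult_indicator) auto
      finally show ?thesis .
    next
      case False
      then have "mass (\<xi> n) = 0"
        using \<xi> measure_nonneg[of \<Psi> "rays_through T r (\<xi> n)"] unfolding heavy_def
        by (simp only: mem_Collect_eq) (metis less_eq_real_def)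
      moreover have "(\<integral>\<^sup>+v. (ennreal (mass v) * ennreal (lik v \<sigma>)) * indicator {\<xi> n} v \<partial>count_space (heavy n))
        = (\<integral>\<^sup>+v. 0 \<partial>count_space (heavy n))"
        using False by (intro nn_integral_cong) (auto simp: indicator_def)
      ultimately show ?thesis by simp
    qed
    finally show "ennreal (mass (\<xi> n)) * ennreal (lik (\<xi> n) \<sigma>) =
      (\<integral>\<^sup>+v. indicator (rays_through T r v) \<xi> * (ennreal (mass v) * ennreal (lik v \<sigma>)) \<partial>count_space (heavy n))"
      by simp
  qed
  have "(\<lambda>p. \<Sum>n. \<integral>\<^sup>+v. indicator (rays_through T r v) (fst p) *
      (ennreal (mass v) * ennreal (lik v (snd p))) \<partial>count_space (heavy n)) \<in> borel_measurable (\<Phi> \<Otimes>\<^sub>M P)"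
  proof (intro borel_measurable_suminf_order borel_measurable_nn_integral_count_space countable_heavy
      borel_measurable_times_ennreal)
    fix n v assume "v \<in> heavy n"
    then have "rays_through T r v \<in> sets \<Phi>"
      using heavy_subset rays_through_in_sets[of v T r] \<Phi> by auto
    then show "(\<lambda>p. indicator (rays_through T r v) (fst p)) \<in> borel_measurable (\<Phi> \<Otimes>\<^sub>M P)"
      by (intro measurable_compose[OF measurable_fst] borel_measurable_indicator)
    show "(\<lambda>p. ennreal (lik v (snd p))) \<in> borel_measurable (\<Phi> \<Otimes>\<^sub>M P)"
      by (rule measurable_compose[OF measurable_snd lik_measurable])
  qed auto
  then show ?thesis
    by (subst measurable_cong[where g = "\<lambda>p. \<Sum>n. \<integral>\<^sup>+v. indicator (rays_through T r v) (fst p) *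
      (ennreal (mass v) * ennreal (lik v (snd p))) \<partial>count_space (heavy n)"])
      (auto simp: space_pair_measure sp eq)
qed

text \<open>With \<open>c = H + 2 \<delta>\<close> below the local dimension, eventually \<open>\<Psi> (\<xi> n) \<le> exp (- c n)\<close> and
\<open>lik (\<xi> n) \<le> exp ((n + 1) (H + \<delta>))\<close>, so the terms are dominated by a geometric series of ratio
\<open>exp (- \<delta>)\<close>.\<close>

lemma ray_lik_finite:
  assumes \<xi>: "\<xi> \<in> rays_dim_above T r \<Psi> (rel_entropy \<nu> \<mu>)"
  shows "AE \<sigma> in P_ray \<xi>. ray_lik \<xi> \<sigma> \<noteq> \<infinity>"
proof -
  let ?h = "rel_entropy \<nu> \<mu>"
  have ray: "\<xi> \<in> rays T r" and dim: "ereal ?h < local_dim T r \<Psi> \<xi>"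
    using \<xi> by (auto simp: rays_dim_above_def)
  from ereal_dense2[OF dim] obtain c where c: "ereal c < local_dim T r \<Psi> \<xi>" "?h < c" by auto
  define \<delta> where "\<delta> = (c - ?h) / 2"
  have \<delta>: "0 < \<delta>" "c = ?h + 2 * \<delta>" using c(2) by (auto simp: \<delta>_def field_simps)
  have mass: "\<forall>\<^sub>F n in sequentially. mass (\<xi> n) \<le> exp (- c * real n)"
    using less_LiminfD[OF c(1)[unfolded local_dim_def]] eventually_gt_at_top[of 0]
  proof eventually_elim
    case (elim n)
    show ?case
    proof (cases "mass (\<xi> n) = 0")
      case False
      then have pos: "0 < mass (\<xi> n)" using measure_nonneg[of \<Psi> "rays_through T r (\<xi> n)"] by linarith
      have "c < - ln (mass (\<xi> n)) / real n" using elim(1) False by (simp add: Let_def)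
      then have "c * real n < - ln (mass (\<xi> n))" using elim(2) by (simp only: pos_less_divide_eq of_nat_0_less_iff)
      then have "ln (mass (\<xi> n)) \<le> - c * real n" by simp
      then have "exp (ln (mass (\<xi> n))) \<le> exp (- c * real n)" by (simp only: exp_le_cancel_iff)
      then show ?thesis using pos by simp
    qed simp
  qed
  show ?thesis
    using lik_growth[OF ray]
  proof (rule AE_mp, intro AE_I2 impI)
    fix \<sigma> assume lim: "(\<lambda>n. ln (lik (\<xi> n) \<sigma>) / real (Suc n)) \<longlonglongrightarrow> ?h"
    have lik: "\<forall>\<^sub>F n in sequentially. ln (lik (\<xi> n) \<sigma>) / real (Suc n) < ?h + \<delta>"
      by (rule order_tendstoD(2)[OF lim]) (use \<delta> in simp)
    have "\<forall>\<^sub>F n in sequentially. norm (mass (\<xi> n) * lik (\<xi> n) \<sigma>) \<le> exp (?h + \<delta>) * exp (- \<delta>) ^ n"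
      using mass lik
    proof eventually_elim
      case (elim n)
      have "ln (lik (\<xi> n) \<sigma>) \<le> (?h + \<delta>) * real (Suc n)"
        using elim(2) by (simp add: pos_divide_less_eq less_imp_le)
      then have "exp (ln (lik (\<xi> n) \<sigma>)) \<le> exp ((?h + \<delta>) * real (Suc n))" by (simp only: exp_le_cancel_iff)
      then have "lik (\<xi> n) \<sigma> \<le> exp ((?h + \<delta>) * real (Suc n))" using lik_pos by simp
      then have "mass (\<xi> n) * lik (\<xi> n) \<sigma> \<le> exp (- c * real n) * exp ((?h + \<delta>) * real (Suc n))"
        using elim(1) lik_pos[of "\<xi> n" \<sigma>] by (intro mult_mono) auto
      also have "\<dots> = exp (?h + \<delta>) * exp (- \<delta>) ^ n"
        unfolding exp_of_nat_mult[symmetric] exp_add[symmetric] \<delta>(2)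
        by (simp add: algebra_simps)
      finally show ?case using lik_pos[of "\<xi> n" \<sigma>] by simp
    qed
    then have "summable (\<lambda>n. mass (\<xi> n) * lik (\<xi> n) \<sigma>)"
      by (rule summable_comparison_test_ev) (use \<delta>(1) in \<open>intro summable_mult summable_geometric, simp\<close>)
    moreover have "0 \<le> mass (\<xi> n) * lik (\<xi> n) \<sigma>" for n
      using lik_pos[of "\<xi> n" \<sigma>] by simp
    ultimately have "(\<Sum>n. ennreal (mass (\<xi> n) * lik (\<xi> n) \<sigma>)) = ennreal (\<Sum>n. mass (\<xi> n) * lik (\<xi> n) \<sigma>)"
      by (intro suminf_ennreal2)
    moreover have "ennreal (mass (\<xi> n) * lik (\<xi> n) \<sigma>) = ennreal (mass (\<xi> n)) * ennreal (lik (\<xi> n) \<sigma>)" for n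
      using lik_pos[of "\<xi> n" \<sigma>] by (intro ennreal_mult) auto
    ultimately show "ray_lik \<xi> \<sigma> \<noteq> \<infinity>" by (simp add: ray_lik_def)
  qed
qed

section \<open>Truncated second moment on finitely many vertices\<close>

text \<open>The likelihood ratio, on the vertices in \<open>F\<close>, of the planted law of \<open>\<xi>\<close> with respect to the product law
of \<open>\<mu>\<close>.\<close>

definition ray_density :: "'v set \<Rightarrow> (nat \<Rightarrow> 'v) \<Rightarrow> ('v \<Rightarrow> 'l) \<Rightarrow> ennreal" where
  "ray_density F \<xi> \<sigma> = ennreal (\<Prod>v\<in>F. if v \<in> range \<xi> then ratio (\<sigma> v) else 1)"

definition ray_lik_on :: "'v set \<Rightarrow> (nat \<Rightarrow> 'v) \<Rightarrow> ('v \<Rightarrow> 'l) \<Rightarrow> ennreal" where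
  "ray_lik_on F \<xi> \<sigma> = (\<Sum>v\<in>F \<inter> range \<xi>. ennreal (mass v) * ennreal (lik v \<sigma>))"

lemma depends_on_ray_density: "depends_on F (ray_density F \<xi>)"
proof -
  have "depends_on F (\<lambda>\<sigma>. \<Prod>v\<in>F. if v \<in> range \<xi> then ratio (\<sigma> v) else 1)"
    by (rule depends_on_prod[where f = "\<lambda>v a. if v \<in> range \<xi> then ratio a else 1"]) simp
  then show ?thesis
    unfolding ray_density_def by (rule depends_on_compose)
qed

lemma ray_density_measurable:
  assumes \<Phi>: "sets \<Phi> = sets (boundary T r)" and F: "finite F" "F \<subseteq> V"
  shows "(\<lambda>\<xi>. ray_density F \<xi> \<sigma>) \<in> borel_measurable \<Phi>"
proof -
  have sp: "space \<Phi> = rays T r" using sets_eq_imp_space_eq[OF \<Phi>] by simp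
  have [measurable]: "rays_through T r v \<in> sets \<Phi>" if "v \<in> F" for v
    using F that rays_through_in_sets[of v T r] \<Phi> by auto
  have "(\<lambda>\<xi>. ennreal (\<Prod>v\<in>F. if \<xi> \<in> rays_through T r v then ratio (\<sigma> v) else 1)) \<in> borel_measurable \<Phi>"
    by measurable
  then show ?thesis
    by (subst measurable_cong[where g = "\<lambda>\<xi>. ennreal (\<Prod>v\<in>F. if \<xi> \<in> rays_through T r v then ratio (\<sigma> v) else 1)"])
      (auto simp: ray_density_def sp rays_through_def intro!: arg_cong[where f = ennreal] prod.cong)
qed

lemma nn_integral_P_ray:
  assumes F: "finite F" "F \<subseteq> V" and g: "depends_on F g"
  shows "(\<integral>\<^sup>+\<sigma>. g \<sigma> \<partial>P_ray \<xi>) = (\<integral>\<^sup>+\<sigma>. g \<sigma> * ray_density F \<xi> \<sigma> \<partial>P)"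
proof -
  have "(\<Prod>v\<in>F. pmf (ray_law \<xi> v) (\<sigma> v) / pmf \<mu> (\<sigma> v)) =
      (\<Prod>v\<in>F. if v \<in> range \<xi> then ratio (\<sigma> v) else 1)" for \<sigma>
    by (intro prod.cong refl) (use pos_\<mu> in \<open>simp add: ratio_def less_imp_neq[symmetric]\<close>)
  then show ?thesis
    unfolding ray_density_def using nn_integral_change_law[OF F g, of "\<lambda>_. \<mu>" "ray_law \<xi>"] pos_\<mu> by simp
qed

text \<open>The factors of \<open>ray_density F \<zeta>\<close> at vertices off \<open>\<xi>\<close> only change the law of labels on which the rest of the
integrand does not depend, so they integrate to one; the factors at common vertices remain.\<close>

lemma nn_integral_two_rays:
  assumes F: "finite F" "F \<subseteq> V" and g: "depends_on (F \<inter> range \<xi>) g"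
  shows "(\<integral>\<^sup>+\<sigma>. g \<sigma> * ray_density F \<zeta> \<sigma> \<partial>P_ray \<xi>) =
    (\<integral>\<^sup>+\<sigma>. g \<sigma> * ennreal (\<Prod>v\<in>F \<inter> range \<xi> \<inter> range \<zeta>. ratio (\<sigma> v)) \<partial>P_ray \<xi>)"
proof -
  define common where "common \<sigma> = g \<sigma> * ennreal (\<Prod>v\<in>F \<inter> range \<xi> \<inter> range \<zeta>. ratio (\<sigma> v))" for \<sigma>
  \<comment> \<open>The density of this law with respect to the planted law of \<open>\<xi>\<close> consists of the factors of \<open>ray_density F \<zeta>\<close> off \<open>\<xi>\<close>.\<close>
  define \<kappa> where "\<kappa> v = (if v \<in> range \<xi> \<union> range \<zeta> then \<nu> else \<mu>)" for v
  have dep: "depends_on (F \<inter> range \<xi>) common"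
  proof -
    have "depends_on (F \<inter> range \<xi>) (\<lambda>\<sigma>. \<Prod>v\<in>F \<inter> range \<xi> \<inter> range \<zeta>. ratio (\<sigma> v))"
      by (rule depends_on_prod) simp
    then show ?thesis
      unfolding common_def by (rule depends_on_compose2[OF g, where h = "\<lambda>x y. x * ennreal y"])
  qed
  then have dep_F: "depends_on F common" by (rule depends_on_mono) auto
  have fin: "finite (F \<inter> range \<xi>)" "F \<inter> range \<xi> \<subseteq> V" using F by auto
  have "(\<Prod>v\<in>F. if v \<in> range \<zeta> then ratio (\<sigma> v) else 1) =
      (\<Prod>v\<in>F \<inter> range \<xi> \<inter> range \<zeta>. ratio (\<sigma> v)) * (\<Prod>v\<in>F. pmf (\<kappa> v) (\<sigma> v) / pmf (ray_law \<xi> v) (\<sigma> v))" for \<sigma>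
  proof -
    have "(\<Prod>v\<in>F \<inter> range \<xi> \<inter> range \<zeta>. ratio (\<sigma> v)) = (\<Prod>v\<in>F. if v \<in> range \<xi> \<inter> range \<zeta> then ratio (\<sigma> v) else 1)"
      using F(1) by (simp add: prod.inter_restrict Int_assoc)
    then show ?thesis
      unfolding prod.distrib[symmetric]
      using pos_\<mu> pos_\<nu> by (auto intro!: prod.cong simp: prod.distrib[symmetric] \<kappa>_def ratio_def less_imp_neq[symmetric])
  qed
  then have "(\<integral>\<^sup>+\<sigma>. g \<sigma> * ray_density F \<zeta> \<sigma> \<partial>P_ray \<xi>) =
      (\<integral>\<^sup>+\<sigma>. common \<sigma> * ennreal (\<Prod>v\<in>F. pmf (\<kappa> v) (\<sigma> v) / pmf (ray_law \<xi> v) (\<sigma> v)) \<partial>P_ray \<xi>)"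
    by (simp add: ray_density_def common_def ennreal_mult prod_nonneg ratio_pos less_imp_le mult.assoc)
  also have "\<dots> = (\<integral>\<^sup>+\<sigma>. common \<sigma> \<partial>label_law V \<kappa>)"
    using pos_\<mu> pos_\<nu> by (intro nn_integral_change_law[symmetric] F dep_F) auto
  also have "\<dots> = (\<integral>\<^sup>+\<sigma>. common \<sigma> \<partial>P_ray \<xi>)"
    by (rule nn_integral_finite_coords_cong[OF fin dep]) (auto simp: \<kappa>_def)
  finally show ?thesis by (simp add: common_def)
qed

text \<open>The common vertices of the two rays in \<open>F\<close> are the path to their last common vertex in \<open>F\<close>, so the
product on the left is one of the terms on the right.\<close>

lemma common_ratio_le:
  assumes F: "finite F" "r \<in> F" "\<And>v. v \<in> F \<Longrightarrow> path_to v \<subseteq> F"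
    and \<xi>: "\<xi> \<in> rays T r" and \<zeta>: "\<zeta> \<in> rays T r"
  shows "ennreal (\<Prod>v\<in>F \<inter> range \<xi> \<inter> range \<zeta>. ratio (\<sigma> v)) \<le>
    (\<Sum>v\<in>F \<inter> range \<xi>. indicator (rays_through T r v) \<zeta> * ennreal (lik v \<sigma>))"
proof -
  define N where "N = {n. \<xi> n \<in> F \<and> \<xi> n = \<zeta> n}"
  have "N \<subseteq> \<xi> -` F" by (auto simp: N_def)
  then have fin: "finite N" by (rule finite_subset) (rule finite_vimageI[OF F(1) ray_inj[OF \<xi>]])
  have "0 \<in> N" using F(2) \<xi> \<zeta> unfolding N_def rays_def by simp
  define k where "k = Max N"
  have "k \<in> N" unfolding k_def using fin \<open>0 \<in> N\<close> by (intro Max_in) auto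
  then have k: "\<xi> k \<in> F" "\<xi> k = \<zeta> k" by (auto simp: N_def)
  have "F \<inter> range \<xi> \<inter> range \<zeta> = \<xi> ` {..k}"
  proof
    show "F \<inter> range \<xi> \<inter> range \<zeta> \<subseteq> \<xi> ` {..k}"
    proof
      fix v assume "v \<in> F \<inter> range \<xi> \<inter> range \<zeta>"
      then obtain n m where v: "v \<in> F" "v = \<xi> n" and eq: "\<xi> n = \<zeta> m" by auto
      from rays_meet[OF tree \<xi> \<zeta> eq] v eq have "n \<in> N" by (simp add: N_def)
      then have "n \<le> k" unfolding k_def using fin by simp
      then show "v \<in> \<xi> ` {..k}" using v by simp
    qed
    have "\<xi> ` {..k} \<subseteq> F" using F(3)[OF k(1)] path_to_ray[OF \<xi>] by simp
    moreover have "\<xi> ` {..k} \<subseteq> range \<zeta>" using rays_meet[OF tree \<xi> \<zeta> k(2)] by auto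
    ultimately show "\<xi> ` {..k} \<subseteq> F \<inter> range \<xi> \<inter> range \<zeta>" by auto
  qed
  then have "ennreal (\<Prod>v\<in>F \<inter> range \<xi> \<inter> range \<zeta>. ratio (\<sigma> v)) = ennreal (lik (\<xi> k) \<sigma>)"
    by (simp add: lik_def path_to_ray[OF \<xi>])
  also have "\<dots> = indicator (rays_through T r (\<xi> k)) \<zeta> * ennreal (lik (\<xi> k) \<sigma>)"
  proof -
    have "\<zeta> \<in> rays_through T r (\<xi> k)" unfolding rays_through_ray[OF \<xi>] using k(2) \<zeta> by simp
    then show ?thesis by simp
  qed
  also have "\<dots> \<le> (\<Sum>v\<in>F \<inter> range \<xi>. indicator (rays_through T r v) \<zeta> * ennreal (lik v \<sigma>))"
    using k(1) F(1) by (intro member_le_sum) auto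
  finally show ?thesis .
qed

lemma ray_lik_on_le:
  assumes "finite F" "\<xi> \<in> rays T r" shows "ray_lik_on F \<xi> \<sigma> \<le> ray_lik \<xi> \<sigma>"
proof -
  have fin: "finite (\<xi> -` F)" by (rule finite_vimageI[OF assms(1) ray_inj[OF assms(2)]])
  have "F \<inter> range \<xi> = \<xi> ` (\<xi> -` F)" by auto
  moreover have "inj_on \<xi> (\<xi> -` F)" using ray_inj[OF assms(2)] by (rule inj_on_subset) simp
  ultimately have "ray_lik_on F \<xi> \<sigma> = (\<Sum>n\<in>\<xi> -` F. ennreal (mass (\<xi> n)) * ennreal (lik (\<xi> n) \<sigma>))"
    unfolding ray_lik_on_def by (simp only: sum.reindex comp_def)
  also have "\<dots> \<le> ray_lik \<xi> \<sigma>"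
    unfolding ray_lik_def using fin by (intro sum_le_suminf) auto
  finally show ?thesis .
qed

lemma depends_on_ray_lik_on:
  assumes F: "\<And>v. v \<in> F \<Longrightarrow> path_to v \<subseteq> F" and \<xi>: "\<xi> \<in> rays T r"
  shows "depends_on (F \<inter> range \<xi>) (ray_lik_on F \<xi>)"
  unfolding depends_on_def
proof (intro allI impI)
  fix \<sigma> \<sigma>' :: "'v \<Rightarrow> 'l" assume eq: "\<forall>v\<in>F \<inter> range \<xi>. \<sigma> v = \<sigma>' v"
  have "lik v \<sigma> = lik v \<sigma>'" if "v \<in> F \<inter> range \<xi>" for v
  proof -
    from that obtain n where "v = \<xi> n" by auto
    then have "path_to v \<subseteq> range \<xi>" using path_to_ray[OF \<xi>] by auto
    moreover have "path_to v \<subseteq> F" using that F by blast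
    ultimately have "path_to v \<subseteq> F \<inter> range \<xi>" by blast
    then show ?thesis using eq unfolding lik_def by (intro prod.cong refl) (metis subsetD)
  qed
  then show "ray_lik_on F \<xi> \<sigma> = ray_lik_on F \<xi> \<sigma>'"
    unfolding ray_lik_on_def by (intro sum.cong) auto
qed

text \<open>The inner integral is the likelihood ratio of the mixture on \<open>F\<close>. Its mean under the planted law,
averaged over \<open>\<xi>\<close> and without truncation, would be its second moment under the product law. Averaging
\<open>common_ratio_le\<close> over the second ray \<open>\<zeta>\<close> turns the indicators into \<open>\<Phi>\<close>-masses, which are at most
\<open>C\<close> times the \<open>\<Psi>\<close>-masses, and what is left is \<open>ray_lik_on F \<xi>\<close>. The truncation depends only on labels
of \<open>\<xi>\<close>, as \<open>nn_integral_two_rays\<close> requires.\<close>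

lemma truncated_second_moment:
  assumes F: "finite F" "F \<subseteq> V" "r \<in> F" "\<And>v. v \<in> F \<Longrightarrow> path_to v \<subseteq> F"
    and \<Phi>: "sets \<Phi> = sets (boundary T r)"
    and dom: "\<And>v. v \<in> V \<Longrightarrow> emeasure \<Phi> (rays_through T r v) \<le> ennreal C * ennreal (mass v)"
    and \<xi>: "\<xi> \<in> rays T r"
  shows "(\<integral>\<^sup>+\<sigma>. (\<integral>\<^sup>+\<zeta>. ray_density F \<zeta> \<sigma> \<partial>\<Phi>) * indicator {\<sigma>. ray_lik_on F \<xi> \<sigma> \<le> ennreal K} \<sigma> \<partial>P_ray \<xi>)
    \<le> ennreal C * ennreal K"
proof -
  let ?G = "\<lambda>\<sigma>. indicator {\<sigma>. ray_lik_on F \<xi> \<sigma> \<le> ennreal K} \<sigma> :: ennreal"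
  interpret P\<xi>: prob_space "P_ray \<xi>" by (rule prob_space_label_law)
  have sp: "space \<Phi> = rays T r" using sets_eq_imp_space_eq[OF \<Phi>] by simp
  have G: "depends_on (F \<inter> range \<xi>) ?G"
    using depends_on_compose[OF depends_on_ray_lik_on[OF F(4) \<xi>], of "\<lambda>x. if x \<le> ennreal K then 1 else 0"]
    by (simp add: indicator_def of_bool_def)
  have through: "rays_through T r v \<in> sets \<Phi>" if "v \<in> F" for v
    using F(2) that rays_through_in_sets[of v T r] \<Phi> by auto
  have "(\<integral>\<^sup>+\<sigma>. (\<integral>\<^sup>+\<zeta>. ray_density F \<zeta> \<sigma> \<partial>\<Phi>) * ?G \<sigma> \<partial>P_ray \<xi>) =
      (\<integral>\<^sup>+\<sigma>. \<integral>\<^sup>+\<zeta>. ?G \<sigma> * ray_density F \<zeta> \<sigma> \<partial>\<Phi> \<partial>P_ray \<xi>)"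
    by (intro nn_integral_cong trans[OF mult.commute nn_integral_cmult[symmetric]]
        ray_density_measurable[OF \<Phi> F(1,2)])
  also have "\<dots> = (\<integral>\<^sup>+\<zeta>. \<integral>\<^sup>+\<sigma>. ?G \<sigma> * ray_density F \<zeta> \<sigma> \<partial>P_ray \<xi> \<partial>\<Phi>)"
  proof (rule nn_integral_swap_finite_coords[OF F(1,2), symmetric])
    show "depends_on F (\<lambda>\<sigma>. ?G \<sigma> * ray_density F \<zeta> \<sigma>)" for \<zeta>
      by (rule depends_on_compose2[OF depends_on_mono[OF G] depends_on_ray_density, where h = "(*)"]) auto
    show "(\<lambda>\<zeta>. ?G \<tau> * ray_density F \<zeta> \<tau>) \<in> borel_measurable \<Phi>" for \<tau>
      by (intro borel_measurable_times_ennreal ray_density_measurable[OF \<Phi> F(1,2)]) auto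
  qed
  also have "\<dots> = (\<integral>\<^sup>+\<zeta>. \<integral>\<^sup>+\<sigma>. ?G \<sigma> * ennreal (\<Prod>v\<in>F \<inter> range \<xi> \<inter> range \<zeta>. ratio (\<sigma> v)) \<partial>P_ray \<xi> \<partial>\<Phi>)"
    by (intro nn_integral_cong nn_integral_two_rays[OF F(1,2) G])
  also have "\<dots> \<le> (\<integral>\<^sup>+\<zeta>. \<integral>\<^sup>+\<sigma>. ?G \<sigma> * (\<Sum>v\<in>F \<inter> range \<xi>. indicator (rays_through T r v) \<zeta> * ennreal (lik v \<sigma>)) \<partial>P_ray \<xi> \<partial>\<Phi>)"
    by (intro nn_integral_mono mult_left_mono common_ratio_le F \<xi>) (auto simp: sp)
  also have "\<dots> = (\<integral>\<^sup>+\<sigma>. \<integral>\<^sup>+\<zeta>. ?G \<sigma> * (\<Sum>v\<in>F \<inter> range \<xi>. indicator (rays_through T r v) \<zeta> * ennreal (lik v \<sigma>)) \<partial>\<Phi> \<partial>P_ray \<xi>)"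
  proof (rule nn_integral_swap_finite_coords[OF F(1,2)])
    show "depends_on F (\<lambda>\<sigma>. ?G \<sigma> * (\<Sum>v\<in>F \<inter> range \<xi>. indicator (rays_through T r v) \<zeta> * ennreal (lik v \<sigma>)))" for \<zeta>
      unfolding depends_on_def
    proof (intro allI impI arg_cong2[where f = "(*)"] sum.cong refl)
      fix \<sigma> \<sigma>' :: "'v \<Rightarrow> 'l" assume eq: "\<forall>v\<in>F. \<sigma> v = \<sigma>' v"
      then show "?G \<sigma> = ?G \<sigma>'" by (intro depends_onD[OF G]) auto
      fix v assume "v \<in> F \<inter> range \<xi>"
      then show "ennreal (lik v \<sigma>) = ennreal (lik v \<sigma>')"
        using eq F(4)[of v] by (intro depends_onD[OF depends_on_lik]) auto
    qed
    show "(\<lambda>\<zeta>. ?G \<tau> * (\<Sum>v\<in>F \<inter> range \<xi>. indicator (rays_through T r v) \<zeta> * ennreal (lik v \<tau>))) \<in> borel_measurable \<Phi>" for \<tau>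
      using through by (intro borel_measurable_times_ennreal borel_measurable_sum borel_measurable_const borel_measurable_indicator) auto
  qed
  also have "\<dots> = (\<integral>\<^sup>+\<sigma>. ?G \<sigma> * (\<Sum>v\<in>F \<inter> range \<xi>. emeasure \<Phi> (rays_through T r v) * ennreal (lik v \<sigma>)) \<partial>P_ray \<xi>)"
  proof (rule nn_integral_cong)
    fix \<sigma>
    have m: "(\<lambda>\<zeta>. indicator (rays_through T r v) \<zeta> * ennreal (lik v \<sigma>)) \<in> borel_measurable \<Phi>"
      if "v \<in> F \<inter> range \<xi>" for v
      using through that by (intro borel_measurable_times_ennreal borel_measurable_indicator) auto
    show "(\<integral>\<^sup>+\<zeta>. ?G \<sigma> * (\<Sum>v\<in>F \<inter> range \<xi>. indicator (rays_through T r v) \<zeta> * ennreal (lik v \<sigma>)) \<partial>\<Phi>) =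
      ?G \<sigma> * (\<Sum>v\<in>F \<inter> range \<xi>. emeasure \<Phi> (rays_through T r v) * ennreal (lik v \<sigma>))"
    proof -
      have "(\<integral>\<^sup>+\<zeta>. indicator (rays_through T r v) \<zeta> * ennreal (lik v \<sigma>) \<partial>\<Phi>) =
          emeasure \<Phi> (rays_through T r v) * ennreal (lik v \<sigma>)" if "v \<in> F \<inter> range \<xi>" for v
        using through that by (subst nn_integral_multc) (auto intro: borel_measurable_indicator)
      then have "(\<integral>\<^sup>+\<zeta>. (\<Sum>v\<in>F \<inter> range \<xi>. indicator (rays_through T r v) \<zeta> * ennreal (lik v \<sigma>)) \<partial>\<Phi>) =
          (\<Sum>v\<in>F \<inter> range \<xi>. emeasure \<Phi> (rays_through T r v) * ennreal (lik v \<sigma>))"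
        by (subst nn_integral_sum[OF m]) (auto intro: sum.cong)
      then show ?thesis
        by (subst nn_integral_cmult) (auto intro!: borel_measurable_sum m)
    qed
  qed
  also have "\<dots> \<le> (\<integral>\<^sup>+\<sigma>. ennreal C * ennreal K \<partial>P_ray \<xi>)"
  proof (rule nn_integral_mono)
    fix \<sigma>
    have "(\<Sum>v\<in>F \<inter> range \<xi>. emeasure \<Phi> (rays_through T r v) * ennreal (lik v \<sigma>)) \<le>
        (\<Sum>v\<in>F \<inter> range \<xi>. ennreal C * ennreal (mass v) * ennreal (lik v \<sigma>))"
      using F(2) by (intro sum_mono mult_right_mono dom) auto
    also have "\<dots> = ennreal C * ray_lik_on F \<xi> \<sigma>"
      by (simp add: ray_lik_on_def sum_distrib_left mult.assoc)
    finally have le: "(\<Sum>v\<in>F \<inter> range \<xi>. emeasure \<Phi> (rays_through T r v) * ennreal (lik v \<sigma>)) \<le> ennreal C * ray_lik_on F \<xi> \<sigma>" .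
    show "?G \<sigma> * (\<Sum>v\<in>F \<inter> range \<xi>. emeasure \<Phi> (rays_through T r v) * ennreal (lik v \<sigma>)) \<le> ennreal C * ennreal K"
    proof (cases "ray_lik_on F \<xi> \<sigma> \<le> ennreal K")
      case True
      then have "ennreal C * ray_lik_on F \<xi> \<sigma> \<le> ennreal C * ennreal K" by (intro mult_left_mono) auto
      with le show ?thesis using True by simp
    qed simp
  qed
  also have "\<dots> = ennreal C * ennreal K" by (simp add: P\<xi>.emeasure_space_1)
  finally show ?thesis .
qed

section \<open>Absolute continuity above the relative entropy\<close>

lemma ray_lik_section_measurable: "ray_lik \<xi> \<in> borel_measurable (label_law V \<kappa>)"
  unfolding ray_lik_def[abs_def] by (intro borel_measurable_suminf_order mass_lik_measurable)

definition exceeds :: "real \<Rightarrow> (nat \<Rightarrow> 'v) \<Rightarrow> ('v \<Rightarrow> 'l) set" where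
  "exceeds K \<xi> = {\<sigma> \<in> (\<Pi>\<^sub>E v\<in>V. UNIV). ennreal K < ray_lik \<xi> \<sigma>}"

lemma exceeds_sets: "exceeds K \<xi> \<in> sets (label_law V \<kappa>)"
proof -
  have "ray_lik \<xi> -` {ennreal K <..} \<inter> space (label_law V \<kappa>) \<in> sets (label_law V \<kappa>)"
    by (rule measurable_sets[OF ray_lik_section_measurable]) simp
  moreover have "ray_lik \<xi> -` {ennreal K <..} \<inter> space (label_law V \<kappa>) = exceeds K \<xi>"
    by (auto simp: exceeds_def space_label_law)
  ultimately show ?thesis by simp
qed

lemma exceeds_measurable:
  assumes \<Phi>: "sets \<Phi> = sets (boundary T r)"
  shows "(\<lambda>\<xi>. emeasure (P_ray \<xi>) (exceeds K \<xi>)) \<in> borel_measurable \<Phi>"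
proof (rule emeasure_measurable_subprob_algebra2[OF _ kernel_measurable[OF \<Phi>]])
  have "(\<lambda>(\<xi>, \<sigma>). ray_lik \<xi> \<sigma>) -` {ennreal K <..} \<inter> space (\<Phi> \<Otimes>\<^sub>M P) \<in> sets (\<Phi> \<Otimes>\<^sub>M P)"
    by (rule measurable_sets[OF ray_lik_measurable[OF \<Phi>]]) simp
  moreover have "(\<lambda>(\<xi>, \<sigma>). ray_lik \<xi> \<sigma>) -` {ennreal K <..} \<inter> space (\<Phi> \<Otimes>\<^sub>M P) = Sigma (space \<Phi>) (exceeds K)"
    by (auto simp: space_pair_measure exceeds_def space_label_law)
  ultimately show "Sigma (space \<Phi>) (exceeds K) \<in> sets (\<Phi> \<Otimes>\<^sub>M P)" by simp
qed

text \<open>For almost every hidden ray the sum \<open>ray_lik\<close> is almost surely finite, so its tails vanish, and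
dominated convergence averages this over the ray.\<close>

lemma exceeds_small:
  assumes \<Phi>: "sets \<Phi> = sets (boundary T r)" "prob_space \<Phi>"
    and above: "AE \<xi> in \<Phi>. \<xi> \<in> rays_dim_above T r \<Psi> (rel_entropy \<nu> \<mu>)" and e: "0 < (e::real)"
  shows "\<exists>K>0. (\<integral>\<^sup>+\<xi>. emeasure (P_ray \<xi>) (exceeds K \<xi>) \<partial>\<Phi>) < ennreal e"
proof -
  interpret \<Phi>: prob_space \<Phi> by fact
  have "(\<lambda>k. \<integral>\<^sup>+\<xi>. emeasure (P_ray \<xi>) (exceeds (real (Suc k)) \<xi>) \<partial>\<Phi>) \<longlonglongrightarrow> (\<integral>\<^sup>+\<xi>. 0 \<partial>\<Phi>)"
  proof (rule nn_integral_dominated_convergence[where w = "\<lambda>_. 1"])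
    show "AE \<xi> in \<Phi>. emeasure (P_ray \<xi>) (exceeds (real (Suc k)) \<xi>) \<le> 1" for k
      by (intro AE_I2 subprob_space.subprob_emeasure_le_1 prob_space_imp_subprob_space prob_space_label_law)
    show "AE \<xi> in \<Phi>. (\<lambda>k. emeasure (P_ray \<xi>) (exceeds (real (Suc k)) \<xi>)) \<longlonglongrightarrow> 0"
      using above
    proof eventually_elim
      case (elim \<xi>)
      interpret P\<xi>: prob_space "P_ray \<xi>" by (rule prob_space_label_law)
      have "decseq (\<lambda>k. exceeds (real (Suc k)) \<xi>)"
      proof (rule decseq_SucI)
        fix k
        have "ennreal (real (Suc k)) \<le> ennreal (real (Suc (Suc k)))" by (rule ennreal_leI) simp
        then show "exceeds (real (Suc (Suc k))) \<xi> \<subseteq> exceeds (real (Suc k)) \<xi>"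
          unfolding exceeds_def by (blast intro: le_less_trans)
      qed
      then have "(\<lambda>k. emeasure (P_ray \<xi>) (exceeds (real (Suc k)) \<xi>)) \<longlonglongrightarrow> emeasure (P_ray \<xi>) (\<Inter>k. exceeds (real (Suc k)) \<xi>)"
        using exceeds_sets by (intro Lim_emeasure_decseq) auto
      moreover have "emeasure (P_ray \<xi>) (\<Inter>k. exceeds (real (Suc k)) \<xi>) = 0"
      proof -
        have "AE \<sigma> in P_ray \<xi>. \<sigma> \<notin> (\<Inter>k. exceeds (real (Suc k)) \<xi>)"
          using ray_lik_finite[OF elim]
        proof (rule AE_mp, intro AE_I2 impI notI)
          fix \<sigma> assume fin: "ray_lik \<xi> \<sigma> \<noteq> \<infinity>" and big: "\<sigma> \<in> (\<Inter>k. exceeds (real (Suc k)) \<xi>)"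
          from fin obtain x where x: "ray_lik \<xi> \<sigma> = ennreal x" "0 \<le> x"
            by (cases "ray_lik \<xi> \<sigma>") auto
          obtain k where "x < real k" using reals_Archimedean2 by blast
          then have "ennreal x \<le> ennreal (real (Suc k))" by (intro ennreal_leI) simp
          moreover have "ennreal (real (Suc k)) < ennreal x" using big x(1) by (auto simp: exceeds_def)
          ultimately show False by simp
        qed
        moreover have I: "(\<Inter>k. exceeds (real (Suc k)) \<xi>) \<in> sets (P_ray \<xi>)"
          using exceeds_sets by (intro sets.countable_INT) auto
        ultimately show ?thesis using AE_iff_null_sets[OF I] by (intro null_setsD1) blast
      qed
      ultimately show ?case by simp
    qed
    show "(\<integral>\<^sup>+\<xi>. 1 \<partial>\<Phi>) < \<infinity>" by (simp add: \<Phi>.emeasure_space_1)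
  qed (auto simp: exceeds_measurable[OF \<Phi>(1)])
  then have "\<forall>\<^sub>F k in sequentially. (\<integral>\<^sup>+\<xi>. emeasure (P_ray \<xi>) (exceeds (real (Suc k)) \<xi>) \<partial>\<Phi>) < ennreal e"
    using e by (intro order_tendstoD(2)) auto
  then obtain k where "(\<integral>\<^sup>+\<xi>. emeasure (P_ray \<xi>) (exceeds (real (Suc k)) \<xi>) \<partial>\<Phi>) < ennreal e"
    by (auto simp: eventually_sequentially)
  then show ?thesis by (intro exI[of _ "real (Suc k)"]) simp
qed

text \<open>Let \<open>M\<close> be the likelihood ratio of the mixture on \<open>F\<close>. Where \<open>M \<le> l\<close>, the mixture is at most \<open>l\<close> times the
product law. The event \<open>M > l\<close> is bounded by Markov's inequality where \<open>ray_lik_on F \<xi> \<le> K\<close>, and the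
remaining event is contained in \<open>exceeds K \<xi>\<close>. Only the first term depends on the event, and no term
depends on the size of \<open>F\<close>.\<close>

lemma mixture_cylinder_bound:
  assumes F: "finite F" "F \<subseteq> V" "r \<in> F" "\<And>v. v \<in> F \<Longrightarrow> path_to v \<subseteq> F"
    and \<Phi>: "sets \<Phi> = sets (boundary T r)" "prob_space \<Phi>"
    and dom: "\<And>v. v \<in> V \<Longrightarrow> emeasure \<Phi> (rays_through T r v) \<le> ennreal C * ennreal (mass v)"
    and R: "depends_on F R" and pos: "0 < l" "0 < C" "0 < K"
  shows "emeasure (hidden_ray_labels T \<mu> \<nu> \<Phi>) {\<sigma> \<in> (\<Pi>\<^sub>E v\<in>V. UNIV). R \<sigma>} \<le>
    ennreal l * emeasure P {\<sigma> \<in> (\<Pi>\<^sub>E v\<in>V. UNIV). R \<sigma>} + ennreal (C * K / l) +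
    (\<integral>\<^sup>+\<xi>. emeasure (P_ray \<xi>) (exceeds K \<xi>) \<partial>\<Phi>)"
proof -
  interpret \<Phi>: prob_space \<Phi> by fact
  have sp: "space \<Phi> = rays T r" using sets_eq_imp_space_eq[OF \<Phi>(1)] by simp
  define M where "M \<sigma> = (\<integral>\<^sup>+\<zeta>. ray_density F \<zeta> \<sigma> \<partial>\<Phi>)" for \<sigma>
  let ?B = "{\<sigma> \<in> (\<Pi>\<^sub>E v\<in>V. UNIV). R \<sigma>}"
  let ?B1 = "{\<sigma> \<in> (\<Pi>\<^sub>E v\<in>V. UNIV). R \<sigma> \<and> M \<sigma> \<le> ennreal l}"
  have dep_M: "depends_on F M"
    unfolding depends_on_def M_def
    by (intro allI impI nn_integral_cong) (rule depends_onD[OF depends_on_ray_density], auto)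
  have R1: "depends_on F (\<lambda>\<sigma>. R \<sigma> \<and> M \<sigma> \<le> ennreal l)"
    by (rule depends_on_compose2[OF R dep_M, where h = "\<lambda>x y. x \<and> y \<le> ennreal l"])
  have B1: "?B1 \<in> sets (label_law V \<kappa>)" for \<kappa> by (rule cylinder_in_sets[OF F(1,2) R1])
  have B: "?B \<in> sets (label_law V \<kappa>)" for \<kappa> by (rule cylinder_in_sets[OF F(1,2) R])
  have small: "(\<integral>\<^sup>+\<xi>. emeasure (P_ray \<xi>) ?B1 \<partial>\<Phi>) \<le> ennreal l * emeasure P ?B"
  proof -
    have dep_b: "depends_on F (\<lambda>\<sigma>. of_bool (R \<sigma> \<and> M \<sigma> \<le> ennreal l) :: ennreal)"
      by (rule depends_on_compose[OF R1])
    have "(\<integral>\<^sup>+\<xi>. emeasure (P_ray \<xi>) ?B1 \<partial>\<Phi>) =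
        (\<integral>\<^sup>+\<xi>. \<integral>\<^sup>+\<sigma>. of_bool (R \<sigma> \<and> M \<sigma> \<le> ennreal l) * ray_density F \<xi> \<sigma> \<partial>P \<partial>\<Phi>)"
      unfolding emeasure_cylinder[OF F(1,2) R1] nn_integral_P_ray[OF F(1,2) dep_b] ..
    also have "\<dots> = (\<integral>\<^sup>+\<sigma>. \<integral>\<^sup>+\<xi>. of_bool (R \<sigma> \<and> M \<sigma> \<le> ennreal l) * ray_density F \<xi> \<sigma> \<partial>\<Phi> \<partial>P)"
      by (intro nn_integral_swap_finite_coords[OF F(1,2)] borel_measurable_times_ennreal
          ray_density_measurable[OF \<Phi>(1) F(1,2)] borel_measurable_const
          depends_on_compose2[OF dep_b depends_on_ray_density, where h = "(*)"])
    also have "\<dots> = (\<integral>\<^sup>+\<sigma>. of_bool (R \<sigma> \<and> M \<sigma> \<le> ennreal l) * M \<sigma> \<partial>P)"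
      unfolding M_def by (intro nn_integral_cong nn_integral_cmult ray_density_measurable[OF \<Phi>(1) F(1,2)])
    also have "\<dots> \<le> (\<integral>\<^sup>+\<sigma>. ennreal l * of_bool (R \<sigma>) \<partial>P)"
      by (intro nn_integral_mono) auto
    also have "\<dots> = ennreal l * emeasure P ?B"
      unfolding emeasure_cylinder[OF F(1,2) R]
      by (rule nn_integral_cmult) (rule borel_measurable_finite_coords[OF F(1,2) depends_on_compose[OF R]])
    finally show ?thesis .
  qed
  have point: "emeasure (P_ray \<xi>) ?B \<le>
      emeasure (P_ray \<xi>) ?B1 + ennreal (C * K / l) + emeasure (P_ray \<xi>) (exceeds K \<xi>)"
    if "\<xi> \<in> space \<Phi>" for \<xi>
  proof -
    have \<xi>: "\<xi> \<in> rays T r" using that sp by simp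
    let ?G = "\<lambda>\<sigma>. indicator {\<sigma>. ray_lik_on F \<xi> \<sigma> \<le> ennreal K} \<sigma> :: ennreal"
    let ?D = "{\<sigma> \<in> (\<Pi>\<^sub>E v\<in>V. UNIV). ennreal l < M \<sigma> \<and> ray_lik_on F \<xi> \<sigma> \<le> ennreal K}"
    have dep_S: "depends_on F (ray_lik_on F \<xi>)"
      by (rule depends_on_mono[OF depends_on_ray_lik_on[OF F(4) \<xi>]]) auto
    have RD: "depends_on F (\<lambda>\<sigma>. ennreal l < M \<sigma> \<and> ray_lik_on F \<xi> \<sigma> \<le> ennreal K)"
      by (rule depends_on_compose2[OF dep_M dep_S, where h = "\<lambda>x y. ennreal l < x \<and> y \<le> ennreal K"])
    have D: "?D \<in> sets (P_ray \<xi>)" by (rule cylinder_in_sets[OF F(1,2) RD])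
    have MG: "(\<lambda>\<sigma>. M \<sigma> * ?G \<sigma>) \<in> borel_measurable (P_ray \<xi>)"
    proof -
      have "depends_on F (\<lambda>\<sigma>. M \<sigma> * ?G \<sigma>)"
        using depends_on_compose2[OF dep_M dep_S, of "\<lambda>x y. x * of_bool (y \<le> ennreal K)"]
        by (simp add: indicator_def)
      then show ?thesis by (rule borel_measurable_finite_coords[OF F(1,2)])
    qed
    have D_le: "emeasure (P_ray \<xi>) ?D \<le> ennreal (C * K / l)"
    proof -
      have "emeasure (P_ray \<xi>) ?D = (\<integral>\<^sup>+\<sigma>. of_bool (ennreal l < M \<sigma> \<and> ray_lik_on F \<xi> \<sigma> \<le> ennreal K) \<partial>P_ray \<xi>)"
        by (rule emeasure_cylinder[OF F(1,2) RD])
      also have "\<dots> \<le> (\<integral>\<^sup>+\<sigma>. ennreal (1 / l) * (M \<sigma> * ?G \<sigma>) \<partial>P_ray \<xi>)"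
      proof (rule nn_integral_mono)
        fix \<sigma>
        have "1 \<le> ennreal (1 / l) * M \<sigma>" if "ennreal l < M \<sigma>"
        proof -
          have "1 = ennreal (1 / l) * ennreal l"
            using pos by (simp add: ennreal_mult[symmetric])
          also have "\<dots> \<le> ennreal (1 / l) * M \<sigma>"
            using that by (intro mult_left_mono) auto
          finally show ?thesis .
        qed
        then show "of_bool (ennreal l < M \<sigma> \<and> ray_lik_on F \<xi> \<sigma> \<le> ennreal K) \<le> ennreal (1 / l) * (M \<sigma> * ?G \<sigma>)"
          by (auto simp: indicator_def)
      qed
      also have "\<dots> = ennreal (1 / l) * (\<integral>\<^sup>+\<sigma>. M \<sigma> * ?G \<sigma> \<partial>P_ray \<xi>)"
        by (rule nn_integral_cmult[OF MG])
      also have "\<dots> \<le> ennreal (1 / l) * (ennreal C * ennreal K)"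
        unfolding M_def by (intro mult_left_mono truncated_second_moment F \<Phi>(1) dom \<xi>) auto
      also have "\<dots> = ennreal (C * K / l)"
        using pos by (simp add: ennreal_mult[symmetric])
      finally show ?thesis .
    qed
    have "?B \<subseteq> ?B1 \<union> ?D \<union> exceeds K \<xi>"
    proof
      fix \<sigma> assume \<sigma>: "\<sigma> \<in> ?B"
      have "ray_lik_on F \<xi> \<sigma> \<le> ray_lik \<xi> \<sigma>" by (rule ray_lik_on_le[OF F(1) \<xi>])
      then show "\<sigma> \<in> ?B1 \<union> ?D \<union> exceeds K \<xi>"
        using \<sigma> by (auto simp: exceeds_def not_le intro: less_le_trans)
    qed
    then have "emeasure (P_ray \<xi>) ?B \<le> emeasure (P_ray \<xi>) (?B1 \<union> ?D \<union> exceeds K \<xi>)"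
      by (rule emeasure_mono) (intro sets.Un B1 D exceeds_sets)
    also have "\<dots> \<le> emeasure (P_ray \<xi>) (?B1 \<union> ?D) + emeasure (P_ray \<xi>) (exceeds K \<xi>)"
      by (intro emeasure_subadditive sets.Un B1 D exceeds_sets)
    also have "emeasure (P_ray \<xi>) (?B1 \<union> ?D) \<le> emeasure (P_ray \<xi>) ?B1 + emeasure (P_ray \<xi>) ?D"
      by (intro emeasure_subadditive B1 D)
    also have "emeasure (P_ray \<xi>) ?B1 + emeasure (P_ray \<xi>) ?D \<le>
        emeasure (P_ray \<xi>) ?B1 + ennreal (C * K / l)"
      by (rule add_left_mono[OF D_le])
    finally show ?thesis by (simp add: add_right_mono)
  qed
  have "emeasure (hidden_ray_labels T \<mu> \<nu> \<Phi>) ?B = (\<integral>\<^sup>+\<xi>. emeasure (P_ray \<xi>) ?B \<partial>\<Phi>)"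
    by (rule emeasure_mixture[OF \<Phi> B])
  also have "\<dots> \<le> (\<integral>\<^sup>+\<xi>. emeasure (P_ray \<xi>) ?B1 + ennreal (C * K / l) + emeasure (P_ray \<xi>) (exceeds K \<xi>) \<partial>\<Phi>)"
    by (rule nn_integral_mono) (rule point)
  also have "\<dots> = (\<integral>\<^sup>+\<xi>. emeasure (P_ray \<xi>) ?B1 \<partial>\<Phi>) + ennreal (C * K / l) +
      (\<integral>\<^sup>+\<xi>. emeasure (P_ray \<xi>) (exceeds K \<xi>) \<partial>\<Phi>)"
  proof -
    have m: "(\<lambda>\<xi>. emeasure (P_ray \<xi>) ?B1) \<in> borel_measurable \<Phi>"
      by (rule measurable_emeasure_kernel[OF kernel_measurable[OF \<Phi>(1)] B1])
    show ?thesis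
      using m exceeds_measurable[OF \<Phi>(1), of K]
      by (simp add: nn_integral_add \<Phi>.emeasure_space_1)
  qed
  also have "\<dots> \<le> ennreal l * emeasure P ?B + ennreal (C * K / l) +
      (\<integral>\<^sup>+\<xi>. emeasure (P_ray \<xi>) (exceeds K \<xi>) \<partial>\<Phi>)"
    by (intro add_right_mono small)
  finally show ?thesis .
qed

lemma ancestor_closure:
  assumes "finite F" "F \<subseteq> V"
  obtains F' where "finite F'" "F' \<subseteq> V" "F \<subseteq> F'" "r \<in> F'" "\<And>v. v \<in> F' \<Longrightarrow> path_to v \<subseteq> F'"
proof
  let ?F = "insert r F \<union> (\<Union>v\<in>insert r F. path_to v)"
  show "finite ?F" using assms finite_path_to by auto
  show "?F \<subseteq> V" using assms root path_to_subset by auto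
  fix v assume v: "v \<in> ?F"
  have trans: "path_to v \<subseteq> path_to w" if vw: "v \<in> path_to w" for w
  proof -
    from vw obtain \<xi> n i where \<xi>: "\<xi> \<in> rays T r" "\<xi> n = w" "v = \<xi> i" "i \<le> n"
      unfolding path_to_def by blast
    have "path_to v = \<xi> ` {..i}" "path_to w = \<xi> ` {..n}"
      using path_to_ray[OF \<xi>(1), of i] path_to_ray[OF \<xi>(1), of n] \<xi>(2,3) by simp_all
    then show ?thesis using \<xi>(4) by (simp add: image_mono)
  qed
  show "path_to v \<subseteq> ?F"
  proof (cases "v \<in> insert r F")
    case False
    then obtain w where "w \<in> insert r F" "v \<in> path_to w" using v by blast
    then show ?thesis using trans by blast
  qed blast
qed auto

text \<open>Choose \<open>K\<close> to make the last term of \<open>mixture_cylinder_bound\<close> small, then \<open>l\<close> for the middle term, and then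
the probability of the cylinder.\<close>

lemma mixture_absolutely_continuous:
  assumes \<Phi>: "sets \<Phi> = sets (boundary T r)" "prob_space \<Phi>"
    and dom: "\<And>v. v \<in> V \<Longrightarrow> emeasure \<Phi> (rays_through T r v) \<le> ennreal C * ennreal (mass v)"
    and C: "0 < C"
    and above: "AE \<xi> in \<Phi>. \<xi> \<in> rays_dim_above T r \<Psi> (rel_entropy \<nu> \<mu>)"
    and Q: "prob_space (hidden_ray_labels T \<mu> \<nu> \<Phi>)"
  shows "absolutely_continuous P (hidden_ray_labels T \<mu> \<nu> \<Phi>)"
proof (rule absolutely_continuous_by_cylinders)
  let ?Q = "hidden_ray_labels T \<mu> \<nu> \<Phi>"
  interpret Q: prob_space ?Q by fact
  interpret P: prob_space P by (rule prob_space_label_law)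
  show "finite_measure ?Q" by (rule Q.finite_measure_axioms)
  show "sets ?Q = sets P" by (rule sets_mixture[OF \<Phi>])
  fix e :: real assume "0 < e"
  then obtain K where K: "0 < K" "(\<integral>\<^sup>+\<xi>. emeasure (P_ray \<xi>) (exceeds K \<xi>) \<partial>\<Phi>) < ennreal (e / 3)"
    using exceeds_small[OF \<Phi> above, of "e / 3"] by auto
  \<comment> \<open>This value makes the Markov term \<open>C * K / l\<close> equal to \<open>e / 3\<close>.\<close>
  define l where "l = 3 * C * K / e"
  have l: "0 < l" "C * K / l = e / 3" using C K(1) \<open>0 < e\<close> by (auto simp: l_def)
  show "\<exists>\<delta>>0. \<forall>B\<in>cylinders V. measure P B < \<delta> \<longrightarrow> measure ?Q B \<le> e"
  proof (intro exI[of _ "e / (3 * l)"] conjI ballI impI)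
    show "0 < e / (3 * l)" using l \<open>0 < e\<close> by simp
    fix B assume B: "B \<in> cylinders V" and PB: "measure P B < e / (3 * l)"
    from B obtain R F0 where B_eq: "B = {\<sigma> \<in> (\<Pi>\<^sub>E v\<in>V. UNIV). R \<sigma>}" and F0: "finite F0" "F0 \<subseteq> V" "depends_on F0 R"
      by (auto simp: cylinders_def)
    obtain F where F: "finite F" "F \<subseteq> V" "F0 \<subseteq> F" "r \<in> F" "\<And>v. v \<in> F \<Longrightarrow> path_to v \<subseteq> F"
      using ancestor_closure[OF F0(1,2)] by blast
    have R: "depends_on F R" by (rule depends_on_mono[OF F0(3) F(3)])
    have "emeasure ?Q B \<le> ennreal l * emeasure P B + ennreal (C * K / l) +
        (\<integral>\<^sup>+\<xi>. emeasure (P_ray \<xi>) (exceeds K \<xi>) \<partial>\<Phi>)"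
      unfolding B_eq by (rule mixture_cylinder_bound[OF F(1,2,4,5) \<Phi> dom R l(1) C K(1)])
    also have "\<dots> \<le> ennreal (e / 3) + ennreal (e / 3) + ennreal (e / 3)"
    proof (intro add_mono)
      have "l * measure P B \<le> e / 3" using PB l(1) by (simp add: field_simps)
      then show "ennreal l * emeasure P B \<le> ennreal (e / 3)"
        using l(1) by (simp add: P.emeasure_eq_measure ennreal_mult[symmetric] ennreal_leI)
    qed (use l K in \<open>auto simp: less_imp_le\<close>)
    also have "\<dots> = ennreal e" using \<open>0 < e\<close> by (simp add: ennreal_plus[symmetric] del: ennreal_plus)
    finally show "measure ?Q B \<le> e"
      using \<open>0 < e\<close> by (simp add: Q.emeasure_eq_measure)
  qed
qed

text \<open>A null set of the mixture is null for the planted law of almost every ray, and there the new label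
has positive probability, so \<open>emeasure_fix_coordinate\<close> applies.\<close>

lemma mixture_change_coordinate:
  assumes \<Phi>: "sets \<Phi> = sets (boundary T r)" "prob_space \<Phi>"
    and v: "v \<in> V" and N: "N \<in> null_sets (hidden_ray_labels T \<mu> \<nu> \<Phi>)"
  shows "{\<sigma>\<in>space (hidden_ray_labels T \<mu> \<nu> \<Phi>). \<sigma>(v := t) \<in> N} \<in> null_sets (hidden_ray_labels T \<mu> \<nu> \<Phi>)"
proof -
  let ?Q = "hidden_ray_labels T \<mu> \<nu> \<Phi>"
  let ?N = "{\<sigma>\<in>space P. \<sigma>(v := t) \<in> N}"
  have sp: "space ?Q = space P" using sets_eq_imp_space_eq[OF sets_mixture[OF \<Phi>]] .
  have Ns: "N \<in> sets P" using N sets_mixture[OF \<Phi>] by (simp add: null_sets_def)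
  have Ns': "?N \<in> sets P"
    using measurable_sets[OF measurable_fix_coordinate[OF v] Ns] by (simp add: vimage_def Int_def conj_commute)
  have meas: "(\<lambda>\<xi>. emeasure (P_ray \<xi>) N) \<in> borel_measurable \<Phi>"
    by (rule measurable_emeasure_kernel[OF kernel_measurable[OF \<Phi>(1)] Ns])
  have "(\<integral>\<^sup>+\<xi>. emeasure (P_ray \<xi>) N \<partial>\<Phi>) = 0"
    using N emeasure_mixture[OF \<Phi> Ns] by (simp add: null_sets_def)
  then have "AE \<xi> in \<Phi>. emeasure (P_ray \<xi>) N = 0"
    using nn_integral_0_iff_AE[OF meas] by simp
  then have "AE \<xi> in \<Phi>. emeasure (P_ray \<xi>) ?N = 0"
  proof eventually_elim
    case (elim \<xi>)
    have N\<xi>: "N \<in> sets (P_ray \<xi>)" using Ns by (simp only: sets_label_law)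
    have "space (P_ray \<xi>) = space P" by (simp only: space_label_law)
    then have "ennreal (pmf (ray_law \<xi> v) t) * emeasure (P_ray \<xi>) ?N = emeasure (P_ray \<xi>) {\<sigma>\<in>N. \<sigma> v = t}"
      using emeasure_fix_coordinate[OF v N\<xi>, of t] by simp
    also have "\<dots> \<le> emeasure (P_ray \<xi>) N" using N\<xi> by (intro emeasure_mono) auto
    also have "\<dots> = 0" by (rule elim)
    finally have "ennreal (pmf (ray_law \<xi> v) t) * emeasure (P_ray \<xi>) ?N = 0" by simp
    moreover have "0 < pmf (ray_law \<xi> v) t" using pos_\<mu> pos_\<nu> by simp
    ultimately show ?case by (simp only: mult_eq_0_iff ennreal_eq_0_iff) linarith
  qed
  then have "(\<integral>\<^sup>+\<xi>. emeasure (P_ray \<xi>) ?N \<partial>\<Phi>) = (\<integral>\<^sup>+\<xi>. 0 \<partial>\<Phi>)"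
    by (rule nn_integral_cong_AE)
  then show ?thesis
    using emeasure_mixture[OF \<Phi> Ns'] Ns' by (simp add: null_sets_def sp sets_mixture[OF \<Phi>])
qed

lemma mixture_indistinguishable:
  assumes \<Phi>: "sets \<Phi> = sets (boundary T r)" "prob_space \<Phi>"
    and dom: "\<And>v. v \<in> V \<Longrightarrow> emeasure \<Phi> (rays_through T r v) \<le> ennreal C * ennreal (mass v)"
    and C: "0 < C"
    and above: "AE \<xi> in \<Phi>. \<xi> \<in> rays_dim_above T r \<Psi> (rel_entropy \<nu> \<mu>)"
  shows "indistinguishable (hidden_ray_labels T \<mu> \<nu> \<Phi>) P"
proof -
  have Q: "prob_space (hidden_ray_labels T \<mu> \<nu> \<Phi>)" by (rule prob_space_mixture[OF \<Phi>])
  have ac: "absolutely_continuous P (hidden_ray_labels T \<mu> \<nu> \<Phi>)"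
    by (rule mixture_absolutely_continuous[OF \<Phi> dom C above Q])
  moreover have "absolutely_continuous (hidden_ray_labels T \<mu> \<nu> \<Phi>) P"
    by (rule absolutely_continuous_converse[OF Q sets_mixture[OF \<Phi>] ac mixture_change_coordinate[OF \<Phi>]])
  ultimately show ?thesis
    unfolding indistinguishable_def using sets_mixture[OF \<Phi>] by (intro conjI)
qed

end

section \<open>Indistinguishability and singularity\<close>

theorem theorem1p8:
  fixes T :: "'v pair_pre_digraph" and r :: 'v
    and \<mu> \<nu> :: "'l::finite pmf" and \<Psi> :: "(nat \<Rightarrow> 'v) measure"
  assumes "undirected_tree T" and "r \<in> pverts T" and "infinite (pverts T)"
    and "\<And>v. v \<noteq> r \<Longrightarrow> \<not> leaf T v"
    and "\<mu> \<noteq> \<nu>" and "\<And>\<omega>. pmf \<mu> \<omega> > 0" and "\<And>\<omega>. pmf \<nu> \<omega> > 0"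
    and "prob_space \<Psi>" and "sets \<Psi> = sets (boundary T r)"
  shows "(measure \<Psi> (rays_dim_above T r \<Psi> (rel_entropy \<nu> \<mu>)) > 0 \<longrightarrow>
      indistinguishable
        (hidden_ray_labels T \<mu> \<nu> (uniform_measure \<Psi> (rays_dim_above T r \<Psi> (rel_entropy \<nu> \<mu>))))
        (iid_labels T \<mu>)) \<and>
    (measure \<Psi> (rays_dim_below T r \<Psi> (rel_entropy \<nu> \<mu>)) > 0 \<longrightarrow>
      mutually_singular
        (hidden_ray_labels T \<mu> \<nu> (uniform_measure \<Psi> (rays_dim_below T r \<Psi> (rel_entropy \<nu> \<mu>))))
        (iid_labels T \<mu>))"
proof -
  interpret hidden_ray T r \<mu> \<nu> \<Psi>
    using assms by (intro hidden_ray.intro)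
  have cond: "U \<in> sets \<Psi>" "sets (uniform_measure \<Psi> U) = sets (boundary T r)"
      "prob_space (uniform_measure \<Psi> U)" "AE \<xi> in uniform_measure \<Psi> U. \<xi> \<in> U"
    if U: "0 < measure \<Psi> U" for U
  proof -
    show s: "U \<in> sets \<Psi>" using U measure_notin_sets by fastforce
    show "sets (uniform_measure \<Psi> U) = sets (boundary T r)" by (simp add: sets_\<Psi>)
    show "prob_space (uniform_measure \<Psi> U)"
      using U by (intro prob_space_uniform_measure) (auto simp: \<Psi>.emeasure_eq_measure)
    show "AE \<xi> in uniform_measure \<Psi> U. \<xi> \<in> U" by (rule AE_uniform_measureI[OF s]) simp
  qed
  have iid: "iid_labels T \<mu> = P" by (simp add: iid_labels_def)
  show ?thesis
    unfolding iid
  proof (intro conjI impI)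
    let ?U = "rays_dim_above T r \<Psi> (rel_entropy \<nu> \<mu>)"
    assume U: "0 < measure \<Psi> ?U"
    show "indistinguishable (hidden_ray_labels T \<mu> \<nu> (uniform_measure \<Psi> ?U)) P"
    proof (rule mixture_indistinguishable[OF cond(2,3)[OF U] _ _ cond(4)[OF U]])
      show "0 < 1 / measure \<Psi> ?U" using U by simp
      fix v assume "v \<in> V"
      then have v: "rays_through T r v \<in> sets \<Psi>" by (rule rays_through_sets)
      have "emeasure (uniform_measure \<Psi> ?U) (rays_through T r v) =
          ennreal (measure \<Psi> (?U \<inter> rays_through T r v) / measure \<Psi> ?U)"
        using U by (simp add: emeasure_uniform_measure[OF cond(1)[OF U] v] \<Psi>.emeasure_eq_measure divide_ennreal)
      also have "\<dots> \<le> ennreal (1 / measure \<Psi> ?U * measure \<Psi> (rays_through T r v))"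
        using U v by (intro ennreal_leI) (simp add: divide_right_mono \<Psi>.finite_measure_mono)
      also have "\<dots> = ennreal (1 / measure \<Psi> ?U) * ennreal (measure \<Psi> (rays_through T r v))"
        by (rule ennreal_mult) auto
      finally show "emeasure (uniform_measure \<Psi> ?U) (rays_through T r v) \<le>
        ennreal (1 / measure \<Psi> ?U) * ennreal (measure \<Psi> (rays_through T r v))" .
    qed
  next
    let ?U = "rays_dim_below T r \<Psi> (rel_entropy \<nu> \<mu>)"
    assume U: "0 < measure \<Psi> ?U"
    show "mutually_singular (hidden_ray_labels T \<mu> \<nu> (uniform_measure \<Psi> ?U)) P"
      by (rule mixture_singular[OF cond(2,3)[OF U] cond(4)[OF U]])
  qed
qed

end
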